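(* Let $m\geq 1$. There is an isomorphism of bigraded $\mathbf{Q}$-algebras $A\simeq\mathcal{H}_0$ given by mapping a partition $\lambda=(0\le\lambda_1\leq\ldots\leq\lambda_n)$ to the symmetric polynomial $$P_\lambda(x_1,\ldots,x_n)=\sum_{\sigma\in S_n}x_{\sigma(1)}^{\lambda_1}\cdots x_{\sigma(n)}^{\lambda_n}.$$
   Context: Fix an integer $m\ge1$. For $n\ge 0$ let $\Lambda_n$ be the set of integer sequences $\lambda=(0\leq\lambda_1\leq\ldots\leq\lambda_n)$, called partitions of length $l(\lambda)=n$ (zero parts are counted), and $\Lambda=\bigsqcup_{n\ge0}\Lambda_n$. Put $|\lambda|=\lambda_1+\ldots+\lambda_n$ and $\mathrm{wt}(\lambda)=(m-1)\binom{n}{2}-|\lambda|$. For $N\in\mathbf{N}$, $S^N\lambda=(\lambda_1+N,\ldots,\lambda_n+N)$. The union $\mu\cup\nu$ is the partition whose parts are all parts of $\mu$ and $\nu$ (with multiplicity), sorted in ascending order. $A$ is the $\mathbf{Q}$-vector space with basis $\Lambda$, with bilinear product $\mu*\nu=\mu\cup S^{(m-1)l(\mu)}\nu$, bigraded by placing $\lambda$ in bidegree $(l(\lambda),\mathrm{wt}(\lambda))$. The quantized Cohomological Hall algebra $\mathcal{H}_q$ of the $m$-loop quiver is the $\mathbf{Q}[q]$-module $\bigoplus_{n\geq 0}\mathbf{Q}[q][x_1,\ldots,x_n]^{S_n}$ with the product, for $f_1$ in $n_1$ and $f_2$ in $n_2$ variables, $$(f_1*f_2)(x_1,\ldots,x_{n_1+n_2})=\sum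 f_1(x_{i_1},\ldots,x_{i_{n_1}})f_2(x_{j_1},\ldots,x_{j_{n_2}})\left(\prod_{k=1}^{n_1}\prod_{l=1}^{n_2}(x_{j_l}-qx_{i_k})\right)^{m-1},$$ the sum ranging over all shuffles $\{i_1<\ldots<i_{n_1}\}\cup\{j_1<\ldots<j_{n_2}\}=\{1,\ldots,n_1+n_2\}$. A homogeneous symmetric polynomial of degree $k$ in $n$ variables is placed in bidegree $(n,(m-1)\binom n2-k)$. $\mathcal{H}_0$ is the $\mathbf{Q}$-algebra obtained by specializing $q=0$. *)

theory Defs
  imports
    "HOL-Library.Poly_Mapping"
    "HOL-Computational_Algebra.Polynomial"
    "HOL-Combinatorics.Permutations"
    "HOL-Algebra.Module"
    "HOL-Algebra.QuotRing"
    "HOL-Algebra.Algebraic_Closure_Type"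
begin

section \<open>Bigraded algebras\<close>

text \<open>
  An associative unital, not necessarily commutative algebra \<open>M\<close> over a commutative ring \<open>R\<close>
  (the library's \<open>algebra\<close> locale is about commutative algebras), which is the internal direct
  sum of submodules \<open>D (n, w)\<close>, compatibly with unit and product.
\<close>

locale bigraded_algebra = module + ring M +
  fixes D :: "nat \<times> int \<Rightarrow> 'c set"
  assumes smult_mult_left:
      "\<lbrakk>a \<in> carrier R; x \<in> carrier M; y \<in> carrier M\<rbrakk> \<Longrightarrow>
        (a \<odot>\<^bsub>M\<^esub> x) \<otimes>\<^bsub>M\<^esub> y = a \<odot>\<^bsub>M\<^esub> (x \<otimes>\<^bsub>M\<^esub> y)"
    and smult_mult_right:
      "\<lbrakk>a \<in> carrier R; x \<in> carrier M; y \<in> carrier M\<rbrakk> \<Longrightarrow>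
        x \<otimes>\<^bsub>M\<^esub> (a \<odot>\<^bsub>M\<^esub> y) = a \<odot>\<^bsub>M\<^esub> (x \<otimes>\<^bsub>M\<^esub> y)"
    and part_submodule: "submodule (D d) R M"
    and parts_direct_sum:
      "x \<in> carrier M \<Longrightarrow>
        \<exists>!c. (\<forall>d. c d \<in> D d) \<and> finite {d. c d \<noteq> \<zero>\<^bsub>M\<^esub>} \<and>
             x = (\<Oplus>\<^bsub>M\<^esub>d\<in>{d. c d \<noteq> \<zero>\<^bsub>M\<^esub>}. c d)"
    and one_part: "\<one>\<^bsub>M\<^esub> \<in> D (0, 0)"
    and mult_part:
      "\<lbrakk>x \<in> D (n1, w1); y \<in> D (n2, w2)\<rbrakk> \<Longrightarrow> x \<otimes>\<^bsub>M\<^esub> y \<in> D (n1 + n2, w1 + w2)"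

definition bigraded_algebra_iso ::
  "('a, 'r) ring_scheme \<Rightarrow> ('a, 'b, 'm) module_scheme \<Rightarrow> (nat \<times> int \<Rightarrow> 'b set) \<Rightarrow>
    ('a, 'c, 'n) module_scheme \<Rightarrow> (nat \<times> int \<Rightarrow> 'c set) \<Rightarrow> ('b \<Rightarrow> 'c) \<Rightarrow> bool" where
  "bigraded_algebra_iso R M D N E \<phi> \<longleftrightarrow>
    bigraded_algebra R M D \<and> bigraded_algebra R N E \<and>
    \<phi> \<in> ring_iso M N \<and>
    (\<forall>a\<in>carrier R. \<forall>x\<in>carrier M. \<phi> (a \<odot>\<^bsub>M\<^esub> x) = a \<odot>\<^bsub>N\<^esub> \<phi> x) \<and>
    (\<forall>d. \<phi> ` D d = E d)"


section \<open>Partitions and the algebra \<open>A\<close>\<close>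

text \<open>Partitions are ascending lists; zero parts are allowed and counted by the length.\<close>

definition partitions :: "nat list set" where
  "partitions = {lam. sorted lam}"

definition wt :: "nat \<Rightarrow> nat list \<Rightarrow> int" where
  "wt m lam = (int m - 1) * int (length lam choose 2) - int (sum_list lam)"

definition part_shift :: "nat \<Rightarrow> nat list \<Rightarrow> nat list" where
  "part_shift N lam = map (\<lambda>p. p + N) lam"

definition part_union :: "nat list \<Rightarrow> nat list \<Rightarrow> nat list" where
  "part_union \<mu> \<nu> = sort (\<mu> @ \<nu>)"

definition part_mult :: "nat \<Rightarrow> nat list \<Rightarrow> nat list \<Rightarrow> nat list" where
  "part_mult m \<mu> \<nu> = part_union \<mu> (part_shift ((m - 1) * length \<mu>) \<nu>)"

text \<open>
  The basis vector of a partition \<open>lam\<close> is \<open>Poly_Mapping.single lam 1\<close>. The product is given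
  explicitly since it is not the convolution product of \<^theory>\<open>HOL-Library.Poly_Mapping\<close>.
\<close>

definition A_alg :: "nat \<Rightarrow> (rat, nat list \<Rightarrow>\<^sub>0 rat) module" where
  "A_alg m = \<lparr>
     carrier = {f. Poly_Mapping.keys f \<subseteq> partitions},
     monoid.mult = (\<lambda>f g. \<Sum>\<mu>\<in>Poly_Mapping.keys f. \<Sum>\<nu>\<in>Poly_Mapping.keys g.
        Poly_Mapping.single (part_mult m \<mu> \<nu>)
          (Poly_Mapping.lookup f \<mu> * Poly_Mapping.lookup g \<nu>)),
     one = Poly_Mapping.single [] 1,
     zero = 0,
     add = (+),
     module.smult = (\<lambda>c. Poly_Mapping.map ((*) c))\<rparr>"

definition A_part :: "nat \<Rightarrow> nat \<times> int \<Rightarrow> (nat list \<Rightarrow>\<^sub>0 rat) set" where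
  "A_part m = (\<lambda>(n, w).
     {f \<in> carrier (A_alg m). \<forall>lam\<in>Poly_Mapping.keys f. length lam = n \<and> wt m lam = w})"


section \<open>Symmetric polynomials\<close>

text \<open>
  Polynomials in variables indexed by \<^typ>\<open>nat\<close>, as finitely supported functions on exponent
  vectors. Variables are numbered from \<open>0\<close>, so \<open>x\<^sub>1, \<dots>, x\<^sub>n\<close> become \<open>mvar 0, \<dots>, mvar (n - 1)\<close>.
\<close>

type_synonym 'a mpoly = "(nat \<Rightarrow>\<^sub>0 nat) \<Rightarrow>\<^sub>0 'a"

definition mconst :: "'a::comm_ring_1 \<Rightarrow> 'a mpoly" where
  "mconst c = Poly_Mapping.single 0 c"

definition mvar :: "nat \<Rightarrow> 'a::comm_ring_1 mpoly" where
  "mvar i = Poly_Mapping.single (Poly_Mapping.single i 1) 1"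

definition msubst :: "(nat \<Rightarrow> 'a mpoly) \<Rightarrow> 'a mpoly \<Rightarrow> 'a::comm_ring_1 mpoly" where
  "msubst g f = (\<Sum>e\<in>Poly_Mapping.keys f.
     mconst (Poly_Mapping.lookup f e) *
       (\<Prod>i\<in>Poly_Mapping.keys e. g i ^ Poly_Mapping.lookup e i))"

definition monom_degree :: "(nat \<Rightarrow>\<^sub>0 nat) \<Rightarrow> nat" where
  "monom_degree e = (\<Sum>i\<in>Poly_Mapping.keys e. Poly_Mapping.lookup e i)"

definition sym_polys :: "nat \<Rightarrow> 'a::comm_ring_1 mpoly set" where
  "sym_polys n = {f.
     (\<forall>e\<in>Poly_Mapping.keys f. Poly_Mapping.keys e \<subseteq> {..<n}) \<and>
     (\<forall>\<sigma>. \<sigma> permutes {..<n} \<longrightarrow> msubst (\<lambda>i. mvar (\<sigma> i)) f = f)}"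


section \<open>The quantized Cohomological Hall algebra of the \<open>m\<close>-loop quiver\<close>

text \<open>
  Everything is defined over an arbitrary commutative coefficient ring containing a chosen element
  \<open>q\<close>. A shuffle is given by the set \<open>I = {i\<^sub>1 < \<dots> < i\<^bsub>n1\<^esub>}\<close>, and
  \<open>sorted_list_of_set I ! k\<close> is its element in position \<open>k\<close>, counted from \<open>0\<close>.
\<close>

definition shuffle_mult ::
  "nat \<Rightarrow> 'a::comm_ring_1 \<Rightarrow> nat \<Rightarrow> nat \<Rightarrow> 'a mpoly \<Rightarrow> 'a mpoly \<Rightarrow> 'a mpoly" where
  "shuffle_mult m q n1 n2 f1 f2 =
    (\<Sum>I | I \<subseteq> {..<n1 + n2} \<and> card I = n1.
      let i = (\<lambda>k. sorted_list_of_set I ! k);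
          j = (\<lambda>l. sorted_list_of_set ({..<n1 + n2} - I) ! l)
      in msubst (\<lambda>k. mvar (i k)) f1 * msubst (\<lambda>l. mvar (j l)) f2 *
         (\<Prod>k<n1. \<Prod>l<n2. mvar (j l) - mconst q * mvar (i k)) ^ (m - 1))"

text \<open>
  An element of the direct sum over all numbers of variables is a finitely supported function
  whose value at \<open>n\<close> is a symmetric polynomial in \<open>n\<close> variables.
\<close>

definition coha :: "nat \<Rightarrow> 'a::comm_ring_1 \<Rightarrow> ('a, nat \<Rightarrow>\<^sub>0 'a mpoly) module" where
  "coha m q = \<lparr>
     carrier = {f. \<forall>n. Poly_Mapping.lookup f n \<in> sym_polys n},
     monoid.mult = (\<lambda>f g. \<Sum>n1\<in>Poly_Mapping.keys f. \<Sum>n2\<in>Poly_Mapping.keys g.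
        Poly_Mapping.single (n1 + n2)
          (shuffle_mult m q n1 n2 (Poly_Mapping.lookup f n1) (Poly_Mapping.lookup g n2))),
     one = Poly_Mapping.single 0 1,
     zero = 0,
     add = (+),
     module.smult = (\<lambda>c. Poly_Mapping.map ((*) (mconst c)))\<rparr>"

definition coha_part :: "nat \<Rightarrow> 'a::comm_ring_1 \<Rightarrow> nat \<times> int \<Rightarrow> (nat \<Rightarrow>\<^sub>0 'a mpoly) set" where
  "coha_part m q = (\<lambda>(n, w).
     {f \<in> carrier (coha m q). Poly_Mapping.keys f \<subseteq> {n} \<and>
        (\<forall>e\<in>Poly_Mapping.keys (Poly_Mapping.lookup f n).
           (int m - 1) * int (n choose 2) - int (monom_degree e) = w)})"

text \<open>
  \<open>H_q\<close> has coefficients in \<open>\<rat>[q]\<close>, where \<open>q\<close> is the indeterminate \<open>[:0, 1:]\<close>. In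
  \<open>H_0\<close> the coefficient ring is \<open>\<rat>\<close> and \<open>q = 0\<close>; the lemmas below show that this is the
  quotient of \<open>H_q\<close> by \<open>q H_q\<close>, via evaluation of all coefficients at \<open>q = 0\<close>.
\<close>

definition H_q :: "nat \<Rightarrow> (rat poly, nat \<Rightarrow>\<^sub>0 rat poly mpoly) module" where
  "H_q m = coha m [:0, 1:]"

definition H_0 :: "nat \<Rightarrow> (rat, nat \<Rightarrow>\<^sub>0 rat mpoly) module" where
  "H_0 m = coha m 0"

definition H_0_part :: "nat \<Rightarrow> nat \<times> int \<Rightarrow> (nat \<Rightarrow>\<^sub>0 rat mpoly) set" where
  "H_0_part m = coha_part m 0"

definition P :: "nat list \<Rightarrow> rat mpoly" where
  "P lam = (\<Sum>\<sigma> | \<sigma> permutes {..<length lam}. \<Prod>i<length lam. mvar (\<sigma> i) ^ (lam ! i))"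


section \<open>Specialization at \<open>q = 0\<close>\<close>

definition map_coeffs :: "('a::comm_ring_1 \<Rightarrow> 'b::comm_ring_1) \<Rightarrow> 'a mpoly \<Rightarrow> 'b mpoly" where
  "map_coeffs h = Poly_Mapping.map h"

definition specialize :: "(nat \<Rightarrow>\<^sub>0 rat poly mpoly) \<Rightarrow> (nat \<Rightarrow>\<^sub>0 rat mpoly)" where
  "specialize = Poly_Mapping.map (map_coeffs (\<lambda>c. poly c 0))"

lemma lookup_map_zero:
  "h 0 = 0 \<Longrightarrow> Poly_Mapping.lookup (Poly_Mapping.map h p) k = h (Poly_Mapping.lookup p k)"
  by (simp add: Poly_Mapping.map.rep_eq when_def)

lemma poly_mapping_expand:
  "p = (\<Sum>k\<in>Poly_Mapping.keys p. Poly_Mapping.single k (Poly_Mapping.lookup p k))"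
  by (rule poly_mapping_eqI)
     (auto simp: lookup_sum lookup_single when_def in_keys_iff)

locale coeff_hom =
  fixes h :: "'a::comm_ring_1 \<Rightarrow> 'b::comm_ring_1"
  assumes h_add: "h (x + y) = h x + h y"
    and h_mult: "h (x * y) = h x * h y"
    and h_one: "h 1 = 1"
begin

lemma h_zero: "h 0 = 0"
  using h_add[of 0 0] by simp

lemma h_minus: "h (- x) = - h x"
  using h_add[of x "- x"] by (simp add: h_zero eq_neg_iff_add_eq_0 add.commute)

lemma lookup_mc: "Poly_Mapping.lookup (map_coeffs h p) k = h (Poly_Mapping.lookup p k)"
  unfolding map_coeffs_def by (rule lookup_map_zero) (rule h_zero)

lemma mc_zero: "map_coeffs h 0 = 0"
  by (rule poly_mapping_eqI) (simp add: lookup_mc h_zero)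

lemma mc_add: "map_coeffs h (p + r) = map_coeffs h p + map_coeffs h r"
  by (rule poly_mapping_eqI) (simp add: lookup_mc lookup_add h_add)

lemma mc_uminus: "map_coeffs h (- p) = - map_coeffs h p"
  by (rule poly_mapping_eqI) (simp add: lookup_mc h_minus)

lemma mc_diff: "map_coeffs h (p - r) = map_coeffs h p - map_coeffs h r"
  using mc_add[of p "- r"] by (simp add: mc_uminus)

lemma mc_single: "map_coeffs h (Poly_Mapping.single k c) = Poly_Mapping.single k (h c)"
  by (rule poly_mapping_eqI) (simp add: lookup_mc lookup_single when_def h_zero)

lemma mc_one: "map_coeffs h 1 = 1"
  using mc_single[of 0 1] by (simp add: h_one)

lemma mc_sum: "map_coeffs h (sum F S) = (\<Sum>x\<in>S. map_coeffs h (F x))"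
  by (induction S rule: infinite_finite_induct) (simp_all add: mc_zero mc_add)

lemma mc_mult: "map_coeffs h (p * r) = map_coeffs h p * map_coeffs h r"
proof -
  have *: "map_coeffs h (Poly_Mapping.single k c * Poly_Mapping.single l d) =
      map_coeffs h (Poly_Mapping.single k c) * map_coeffs h (Poly_Mapping.single l d)" for k l c d
    by (simp add: mult_single mc_single h_mult)
  have "map_coeffs h (p * r) =
      map_coeffs h ((\<Sum>k\<in>Poly_Mapping.keys p. Poly_Mapping.single k (Poly_Mapping.lookup p k)) *
        (\<Sum>k\<in>Poly_Mapping.keys r. Poly_Mapping.single k (Poly_Mapping.lookup r k)))"
    by (simp flip: poly_mapping_expand)
  also have "\<dots> =
      map_coeffs h (\<Sum>k\<in>Poly_Mapping.keys p. Poly_Mapping.single k (Poly_Mapping.lookup p k)) *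
      map_coeffs h (\<Sum>k\<in>Poly_Mapping.keys r. Poly_Mapping.single k (Poly_Mapping.lookup r k))"
    by (simp only: sum_product mc_sum *)
  finally show ?thesis
    by (simp flip: poly_mapping_expand)
qed

lemma mc_power: "map_coeffs h (p ^ n) = map_coeffs h p ^ n"
  by (induction n) (simp_all add: mc_one mc_mult)

lemma mc_prod: "map_coeffs h (prod F S) = (\<Prod>x\<in>S. map_coeffs h (F x))"
  by (induction S rule: infinite_finite_induct) (simp_all add: mc_one mc_mult)

lemma mc_mconst: "map_coeffs h (mconst c) = mconst (h c)"
  by (simp add: mconst_def mc_single)

lemma mc_mvar: "map_coeffs h (mvar i) = mvar i"
  by (simp add: mvar_def mc_single h_one)

lemma keys_mc: "Poly_Mapping.keys (map_coeffs h p) \<subseteq> Poly_Mapping.keys p"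
  by (auto simp: in_keys_iff lookup_mc h_zero)

lemma mc_msubst: "map_coeffs h (msubst g f) = msubst (\<lambda>i. map_coeffs h (g i)) (map_coeffs h f)"
proof -
  have "map_coeffs h (msubst g f) = (\<Sum>e\<in>Poly_Mapping.keys f.
      mconst (Poly_Mapping.lookup (map_coeffs h f) e) *
        (\<Prod>i\<in>Poly_Mapping.keys e. map_coeffs h (g i) ^ Poly_Mapping.lookup e i))"
    unfolding msubst_def by (simp add: mc_sum mc_mult mc_prod mc_power mc_mconst lookup_mc)
  also have "\<dots> = msubst (\<lambda>i. map_coeffs h (g i)) (map_coeffs h f)"
    unfolding msubst_def
    by (rule sum.mono_neutral_right) (use keys_mc in \<open>auto simp: in_keys_iff mconst_def\<close>)
  finally show ?thesis .
qed

lemma mc_sym_polys: "f \<in> sym_polys n \<Longrightarrow> map_coeffs h f \<in> sym_polys n"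
proof -
  assume f: "f \<in> sym_polys n"
  have "msubst (\<lambda>i. mvar (\<sigma> i)) (map_coeffs h f) = map_coeffs h f" if "\<sigma> permutes {..<n}" for \<sigma>
    using f that mc_msubst[of "\<lambda>i. mvar (\<sigma> i)" f] by (simp add: sym_polys_def mc_mvar)
  then show ?thesis
    using f keys_mc[of f] by (auto simp: sym_polys_def)
qed

lemma mc_shuffle_mult:
  "map_coeffs h (shuffle_mult m q n1 n2 f g) =
    shuffle_mult m (h q) n1 n2 (map_coeffs h f) (map_coeffs h g)"
  unfolding shuffle_mult_def Let_def
  by (simp add: mc_sum mc_mult mc_power mc_prod mc_diff mc_mconst mc_mvar mc_msubst)

end

interpretation ev0: coeff_hom "\<lambda>c::rat poly. poly c 0"
  by unfold_locales auto

lemma lookup_specialize: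
  "Poly_Mapping.lookup (specialize f) n = map_coeffs (\<lambda>c. poly c 0) (Poly_Mapping.lookup f n)"
  unfolding specialize_def by (rule lookup_map_zero) (rule ev0.mc_zero)

lemma keys_specialize: "Poly_Mapping.keys (specialize f) \<subseteq> Poly_Mapping.keys f"
  by (auto simp: in_keys_iff lookup_specialize ev0.mc_zero)

lemma specialize_single:
  "specialize (Poly_Mapping.single n p) = Poly_Mapping.single n (map_coeffs (\<lambda>c. poly c 0) p)"
  by (rule poly_mapping_eqI)
     (simp add: lookup_specialize lookup_single when_def ev0.mc_zero)

lemma specialize_add: "specialize (f + g) = specialize f + specialize g"
  by (rule poly_mapping_eqI) (simp add: lookup_specialize lookup_add ev0.mc_add)

lemma specialize_sum: "specialize (sum F S) = (\<Sum>x\<in>S. specialize (F x))"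
proof -
  have "specialize 0 = 0"
    by (rule poly_mapping_eqI) (simp add: lookup_specialize ev0.mc_zero)
  then show ?thesis
    by (induction S rule: infinite_finite_induct) (simp_all add: specialize_add)
qed

lemma shuffle_mult_zero:
  "shuffle_mult m q n1 n2 0 g = 0" "shuffle_mult m q n1 n2 f 0 = 0"
  by (simp_all add: shuffle_mult_def msubst_def)

lemma specialize_ring_hom: "specialize \<in> ring_hom (H_q m) (H_0 m)"
proof (rule ring_hom_memI)
  show "specialize f \<in> carrier (H_0 m)" if "f \<in> carrier (H_q m)" for f
    using that by (auto simp: H_q_def H_0_def coha_def lookup_specialize intro: ev0.mc_sym_polys)
  show "specialize (f \<otimes>\<^bsub>H_q m\<^esub> g) = specialize f \<otimes>\<^bsub>H_0 m\<^esub> specialize g" for f g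
  proof -
    let ?s = "\<lambda>n1 n2. Poly_Mapping.single (n1 + n2) (shuffle_mult m 0 n1 n2
        (Poly_Mapping.lookup (specialize f) n1) (Poly_Mapping.lookup (specialize g) n2))"
    have "specialize (f \<otimes>\<^bsub>H_q m\<^esub> g) =
        (\<Sum>n1\<in>Poly_Mapping.keys f. \<Sum>n2\<in>Poly_Mapping.keys g. ?s n1 n2)"
      by (simp add: H_q_def coha_def specialize_sum specialize_single ev0.mc_shuffle_mult
          lookup_specialize)
    also have "\<dots> = (\<Sum>n1\<in>Poly_Mapping.keys f. \<Sum>n2\<in>Poly_Mapping.keys (specialize g). ?s n1 n2)"
      by (intro sum.cong sum.mono_neutral_right refl)
         (use keys_specialize in \<open>auto simp: in_keys_iff shuffle_mult_zero\<close>)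
    also have "\<dots> = (\<Sum>n1\<in>Poly_Mapping.keys (specialize f).
        \<Sum>n2\<in>Poly_Mapping.keys (specialize g). ?s n1 n2)"
      by (intro sum.mono_neutral_right)
         (use keys_specialize in \<open>auto simp: in_keys_iff shuffle_mult_zero\<close>)
    finally show ?thesis
      by (simp add: H_0_def coha_def)
  qed
  show "specialize (f \<oplus>\<^bsub>H_q m\<^esub> g) = specialize f \<oplus>\<^bsub>H_0 m\<^esub> specialize g" for f g
    by (simp add: H_q_def H_0_def coha_def specialize_add)
  show "specialize \<one>\<^bsub>H_q m\<^esub> = \<one>\<^bsub>H_0 m\<^esub>"
    using specialize_single[of 0 1] by (simp add: H_q_def H_0_def coha_def ev0.mc_one)
qed

lemma lookup_mconst_mult:
  "Poly_Mapping.lookup (mconst c * p) e = c * Poly_Mapping.lookup p e"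
  unfolding mconst_def mult_map_scale_conv_mult[symmetric] by (rule lookup_map_zero) simp

lemma specialize_smult: "specialize (c \<odot>\<^bsub>H_q m\<^esub> f) = poly c 0 \<odot>\<^bsub>H_0 m\<^esub> specialize f"
  by (rule poly_mapping_eqI)
     (simp add: H_q_def H_0_def coha_def lookup_specialize lookup_map_zero ev0.mc_mult
        ev0.mc_mconst)

lemma specialize_surj: "specialize ` carrier (H_q m) = carrier (H_0 m)"
proof
  show "specialize ` carrier (H_q m) \<subseteq> carrier (H_0 m)"
    using specialize_ring_hom ring_hom_closed by fast
  interpret c: coeff_hom "\<lambda>c::rat. [:c:]"
    by unfold_locales (auto simp: one_pCons)
  show "carrier (H_0 m) \<subseteq> specialize ` carrier (H_q m)"
  proof
    fix f assume f: "f \<in> carrier (H_0 m)"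
    let ?g = "Poly_Mapping.map (map_coeffs (\<lambda>c. [:c:])) f"
    have lg: "Poly_Mapping.lookup ?g n = map_coeffs (\<lambda>c. [:c:]) (Poly_Mapping.lookup f n)" for n
      by (rule lookup_map_zero) (rule c.mc_zero)
    have "specialize ?g = f"
      by (intro poly_mapping_eqI) (simp add: lookup_specialize lg ev0.lookup_mc c.lookup_mc)
    moreover have "?g \<in> carrier (H_q m)"
      using f by (auto simp: H_q_def H_0_def coha_def lg intro: c.mc_sym_polys)
    ultimately show "f \<in> specialize ` carrier (H_q m)"
      by force
  qed
qed

lemma mconst_zero: "mconst 0 = 0"
  by (simp add: mconst_def)

lemma msubst_mconst_mult: "msubst g (mconst c * f) = mconst c * msubst g f"
proof -
  have "mconst c * msubst g f = (\<Sum>e\<in>Poly_Mapping.keys f.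
      mconst (Poly_Mapping.lookup (mconst c * f) e) *
        (\<Prod>i\<in>Poly_Mapping.keys e. g i ^ Poly_Mapping.lookup e i))"
    unfolding msubst_def sum_distrib_left lookup_mconst_mult
    by (simp add: mconst_def mult_single flip: mult.assoc)
  also have "\<dots> = msubst g (mconst c * f)"
    unfolding msubst_def
    by (rule sum.mono_neutral_right) (auto simp: in_keys_iff lookup_mconst_mult mconst_zero)
  finally show ?thesis ..
qed

lemma specialize_kernel:
  "{f \<in> carrier (H_q m). specialize f = \<zero>\<^bsub>H_0 m\<^esub>} =
    {[:0, 1:] \<odot>\<^bsub>H_q m\<^esub> g | g. g \<in> carrier (H_q m)}"
proof (intro equalityI subsetI)
  let ?q = "[:0, 1::rat:]"
  have smult: "Poly_Mapping.lookup (c \<odot>\<^bsub>H_q m\<^esub> g) n = mconst c * Poly_Mapping.lookup g n" for c g n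
    by (simp add: H_q_def coha_def lookup_map_zero)
  {
    fix f assume "f \<in> {[:0, 1:] \<odot>\<^bsub>H_q m\<^esub> g | g. g \<in> carrier (H_q m)}"
    then obtain g where f: "f = ?q \<odot>\<^bsub>H_q m\<^esub> g" and g: "g \<in> carrier (H_q m)"
      by blast
    have "mconst ?q * p \<in> sym_polys n" if "p \<in> sym_polys n" for p n
      using that
      by (auto simp: sym_polys_def msubst_mconst_mult in_keys_iff lookup_mconst_mult)
    then have "f \<in> carrier (H_q m)"
      using g unfolding f by (simp add: H_q_def coha_def lookup_map_zero)
    moreover have "specialize f = 0"
      by (intro poly_mapping_eqI)
         (simp add: f lookup_specialize smult ev0.lookup_mc lookup_mconst_mult)
    ultimately show "f \<in> {f \<in> carrier (H_q m). specialize f = \<zero>\<^bsub>H_0 m\<^esub>}"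
      by (simp add: H_0_def coha_def)
  next
    fix f assume "f \<in> {f \<in> carrier (H_q m). specialize f = \<zero>\<^bsub>H_0 m\<^esub>}"
    then have f: "f \<in> carrier (H_q m)" and f0: "specialize f = 0"
      by (simp_all add: H_0_def coha_def)
    have "poly (Poly_Mapping.lookup (Poly_Mapping.lookup f n) e) 0 = 0" for n e
      using f0 lookup_specialize[of f n] ev0.lookup_mc[of "Poly_Mapping.lookup f n" e] by simp
    then have shift: "?q * poly_shift 1 (Poly_Mapping.lookup (Poly_Mapping.lookup f n) e) =
        Poly_Mapping.lookup (Poly_Mapping.lookup f n) e" for n e
      by (intro poly_eqI)
         (auto simp: coeff_poly_shift poly_0_coeff_0 coeff_pCons split: nat.split)
    define g where "g = Poly_Mapping.map (Poly_Mapping.map (poly_shift 1)) f"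
    have lg: "Poly_Mapping.lookup (Poly_Mapping.lookup g n) e =
        poly_shift 1 (Poly_Mapping.lookup (Poly_Mapping.lookup f n) e)" for n e
    proof -
      have "Poly_Mapping.map (poly_shift 1) (0 :: rat poly mpoly) = 0"
        by (rule poly_mapping_eqI) (simp add: lookup_map_zero)
      then show ?thesis
        by (simp add: g_def lookup_map_zero)
    qed
    have qg: "mconst ?q * Poly_Mapping.lookup g n = Poly_Mapping.lookup f n" for n
      by (rule poly_mapping_eqI) (simp only: lookup_mconst_mult lg shift)
    have inj: "p = r" if "mconst ?q * p = mconst ?q * r" for p r
    proof (rule poly_mapping_eqI)
      fix e
      have "?q * Poly_Mapping.lookup p e = ?q * Poly_Mapping.lookup r e"
        using that by (metis lookup_mconst_mult)
      then show "Poly_Mapping.lookup p e = Poly_Mapping.lookup r e"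
        by (simp only: mult_cancel_left) simp
    qed
    have "Poly_Mapping.lookup g n \<in> sym_polys n" for n
    proof -
      have fn: "Poly_Mapping.lookup f n \<in> sym_polys n"
        using f by (simp add: H_q_def coha_def)
      have "Poly_Mapping.keys e \<subseteq> {..<n}"
        if "e \<in> Poly_Mapping.keys (Poly_Mapping.lookup g n)" for e
      proof -
        have "e \<in> Poly_Mapping.keys (Poly_Mapping.lookup f n)"
          using that by (auto simp: in_keys_iff lg)
        then show ?thesis
          using fn by (simp add: sym_polys_def)
      qed
      moreover have "msubst (\<lambda>i. mvar (\<sigma> i)) (Poly_Mapping.lookup g n) = Poly_Mapping.lookup g n"
        if "\<sigma> permutes {..<n}" for \<sigma>
        by (rule inj) (use that fn in \<open>simp add: qg sym_polys_def flip: msubst_mconst_mult\<close>)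
      ultimately show ?thesis
        by (simp add: sym_polys_def)
    qed
    then have "g \<in> carrier (H_q m)"
      by (simp add: H_q_def coha_def)
    moreover have "f = ?q \<odot>\<^bsub>H_q m\<^esub> g"
      by (rule poly_mapping_eqI) (simp add: smult qg)
    ultimately show "f \<in> {[:0, 1:] \<odot>\<^bsub>H_q m\<^esub> g | g. g \<in> carrier (H_q m)}"
      by blast
  }
qed

end

theory Submission
  imports Defs
begin

text \<open>
  The linear map \<open>\<phi>\<close> sending \<open>\<lambda>\<close> to \<open>P\<^sub>\<lambda>\<close> is bijective, with inverse sending a symmetric polynomial
  \<open>\<Sum>\<^sub>e p\<^sub>e x\<^sup>e\<close> in \<open>n\<close> variables to \<open>\<Sum>\<^sub>e (p\<^sub>e / n!) sort e\<close>: one composition is averaging over the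
  symmetric group, which fixes symmetric polynomials. It is multiplicative because a permutation of
  \<open>n\<^sub>1 + n\<^sub>2\<close> letters is the same as a shuffle together with permutations of \<open>n\<^sub>1\<close> and \<open>n\<^sub>2\<close> letters.
  The axioms are checked directly only for \<open>A\<close>; in particular the associativity of the product of
  \<open>H\<^sub>0\<close> is transported along \<open>\<phi>\<close>.
\<close>

section \<open>Additive maps on finitely supported functions\<close>

text \<open>Addition can cancel coefficients, so supports do not add up and identities between sums
  over \<open>Poly_Mapping.keys\<close> are awkward to prove head-on. Each map and each product is
  therefore shown once to be additive in every argument, and identities are then tested on
  \<open>Poly_Mapping.single\<close>, with arbitrary coefficients so that additivity is the only
  linearity in use.

  The normalization of \<open>P\<close> matters: it runs over all permutations, so it is the
  monomial symmetric polynomial multiplied by the number of permutations fixing \<lambda>. Products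
  of the \<open>P\<close> are thus again single \<open>P\<close>, with no multiplicity factors, and
  the inverse needs only division by n!, uniformly in \<lambda>, without counting stabilizers or
  choosing orbit representatives.\<close>

lemma additive_ext:
  fixes F G :: "('a \<Rightarrow>\<^sub>0 'b::ab_group_add) \<Rightarrow> 'c::ab_group_add"
  assumes "Modules.additive F" "Modules.additive G"
    and "\<And>k c. k \<in> Poly_Mapping.keys f \<Longrightarrow> F (Poly_Mapping.single k c) = G (Poly_Mapping.single k c)"
  shows "F f = G f"
proof -
  have "F (\<Sum>k\<in>Poly_Mapping.keys f. Poly_Mapping.single k (Poly_Mapping.lookup f k)) =
      G (\<Sum>k\<in>Poly_Mapping.keys f. Poly_Mapping.single k (Poly_Mapping.lookup f k))"
    using assms(3) by (simp add: additive.sum[OF assms(1)] additive.sum[OF assms(2)])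
  then show ?thesis
    by (simp flip: poly_mapping_expand)
qed

lemma additive_compose:
  assumes "Modules.additive F" "Modules.additive G"
  shows "Modules.additive (\<lambda>x. F (G x))"
  by (rule additive.intro) (simp add: additive.add[OF assms(1)] additive.add[OF assms(2)])

text \<open>Keys that cancel in a sum do no harm, because each \<open>h k\<close> sends 0 to
  0.\<close>

lemma additive_sum_keys:
  fixes h :: "'a \<Rightarrow> 'b::ab_group_add \<Rightarrow> 'c::ab_group_add"
  assumes "\<And>k. Modules.additive (h k)"
  shows "Modules.additive (\<lambda>f. \<Sum>k\<in>Poly_Mapping.keys f. h k (Poly_Mapping.lookup f k))"
  by (rule additive.intro, rule setsum_keys_plus_distrib)
     (simp_all add: additive.add[OF assms] additive.zero[OF assms])

lemma additive_single: "Modules.additive (Poly_Mapping.single k)"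
  by (rule additive.intro) (rule single_add)

lemma additive_times: "Modules.additive ((*) (c::'a::ring))"
  by (rule additive.intro) (rule distrib_left)

lemma additive_times': "Modules.additive (\<lambda>x. x * (c::'a::ring))"
  by (rule additive.intro) (rule distrib_right)

lemma additive_map:
  "Modules.additive h \<Longrightarrow> Modules.additive (Poly_Mapping.map h)"
  by (intro additive.intro poly_mapping_eqI)
     (simp add: lookup_map_zero additive.zero lookup_add additive.add)

lemma map_single_additive:
  "Modules.additive h \<Longrightarrow> Poly_Mapping.map h (Poly_Mapping.single k c) = Poly_Mapping.single k (h c)"
  by (rule map_single) (simp add: additive.zero)

text \<open>Common shape of both products. In \<open>A\<close> the indices are partitions and the
  coefficients rationals; in the Hall algebra the indices are numbers of variables and the
  coefficients polynomials. \<open>ext\<close> has the same double sum as the two record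
  definitions, so these unfold to it.\<close>

locale biadditive =
  fixes b :: "'a \<Rightarrow> 'b \<Rightarrow> 'c::ab_group_add \<Rightarrow> 'd::ab_group_add \<Rightarrow> 'e::ab_group_add"
  assumes additive_left: "Modules.additive (\<lambda>x. b k l x y)"
    and additive_right: "Modules.additive (b k l x)"
begin

definition ext :: "('a \<Rightarrow>\<^sub>0 'c) \<Rightarrow> ('b \<Rightarrow>\<^sub>0 'd) \<Rightarrow> 'e" where
  "ext f g = (\<Sum>k\<in>Poly_Mapping.keys f. \<Sum>l\<in>Poly_Mapping.keys g.
      b k l (Poly_Mapping.lookup f k) (Poly_Mapping.lookup g l))"

lemma ext_additive_left: "Modules.additive (\<lambda>f. ext f g)"
  unfolding ext_def
  by (intro additive_sum_keys additive.intro)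
     (simp add: additive.add[OF additive_left] sum.distrib)

lemma ext_additive_right: "Modules.additive (ext f)"
proof -
  \<comment> \<open>The sum over the support of the varying argument has to be outermost for
    \<open>additive_sum_keys\<close> to apply.\<close>
  have "ext f g = (\<Sum>l\<in>Poly_Mapping.keys g. \<Sum>k\<in>Poly_Mapping.keys f.
      b k l (Poly_Mapping.lookup f k) (Poly_Mapping.lookup g l))" for g
    unfolding ext_def by (rule sum.swap)
  moreover have "Modules.additive (\<lambda>g. \<Sum>l\<in>Poly_Mapping.keys g. \<Sum>k\<in>Poly_Mapping.keys f.
      b k l (Poly_Mapping.lookup f k) (Poly_Mapping.lookup g l))"
    by (intro additive_sum_keys additive.intro)
       (simp add: additive.add[OF additive_right] sum.distrib)
  ultimately show ?thesis
    by presburger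
qed

lemma ext_single: "ext (Poly_Mapping.single k c) (Poly_Mapping.single l d) = b k l c d"
  by (simp add: ext_def additive.zero[OF additive_left] additive.zero[OF additive_right])

end


section \<open>Transport of a bigraded algebra structure\<close>

text \<open>Every axiom is pulled back along \<phi>. The separate hypothesis on zero is there
  because \<open>ring_iso\<close> speaks only of products, sums and units.\<close>

lemma bigraded_algebra_transfer:
  assumes M: "bigraded_algebra R M D"
    and iso: "\<phi> \<in> ring_iso M N"
    and zero: "\<phi> \<zero>\<^bsub>M\<^esub> = \<zero>\<^bsub>N\<^esub>"
    and smult: "\<And>a x. a \<in> carrier R \<Longrightarrow> x \<in> carrier M \<Longrightarrow> \<phi> (a \<odot>\<^bsub>M\<^esub> x) = a \<odot>\<^bsub>N\<^esub> \<phi> x"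
    and parts: "\<And>d. \<phi> ` D d = E d"
  shows "bigraded_algebra R N E"
proof -
  interpret M: bigraded_algebra R M D
    by (rule M)
  \<comment> \<open>The image ring comes with \<phi> of zero as its zero; \<open>zero\<close>
    identifies it with that of \<open>N\<close>.\<close>
  have "ring (N\<lparr>zero := \<phi> \<zero>\<^bsub>M\<^esub>\<rparr>)"
    by (rule M.ring_iso_imp_img_ring[OF iso])
  then have N: "ring N"
    by (simp add: zero)
  interpret N: ring N
    by (rule N)
  interpret hom: ring_hom_ring M N \<phi>
    by (rule ring_hom_ringI2[OF M.ring_axioms N]) (use iso in \<open>simp add: ring_iso_def\<close>)
  have bij: "bij_betw \<phi> (carrier M) (carrier N)"
    using iso by (simp add: ring_iso_def)
  then have surj: "\<exists>x\<in>carrier M. y = \<phi> x" if "y \<in> carrier N" for y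
    using that by (auto simp: bij_betw_def)
  have inj: "\<phi> x = \<phi> y \<longleftrightarrow> x = y" if "x \<in> carrier M" "y \<in> carrier M" for x y
    using bij that by (auto simp: bij_betw_def inj_on_eq_iff)
  have D_carrier: "D d \<subseteq> carrier M" for d
    by (rule M.submoduleE(1)[OF M.part_submodule])
  have zero_iff: "\<phi> x = \<zero>\<^bsub>N\<^esub> \<longleftrightarrow> x = \<zero>\<^bsub>M\<^esub>" if "x \<in> carrier M" for x
    using inj[OF that M.zero_closed] by (simp add: zero)
  have mod: "module R N"
  proof (rule moduleI)
    show "cring R" ..
    show "abelian_group N" ..
    note transfer = smult[symmetric] hom.hom_add[symmetric]
    fix a x assume a: "a \<in> carrier R" and "x \<in> carrier N"
    then obtain x' where x': "x' \<in> carrier M" "x = \<phi> x'"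
      using surj by blast
    show "a \<odot>\<^bsub>N\<^esub> x \<in> carrier N"
      by (simp add: transfer x' a)
    show "(a \<oplus>\<^bsub>R\<^esub> b) \<odot>\<^bsub>N\<^esub> x = a \<odot>\<^bsub>N\<^esub> x \<oplus>\<^bsub>N\<^esub> b \<odot>\<^bsub>N\<^esub> x" if "b \<in> carrier R" for b
      by (simp add: transfer x' a that M.smult_l_distr del: hom.hom_add)
    show "a \<otimes>\<^bsub>R\<^esub> b \<odot>\<^bsub>N\<^esub> x = a \<odot>\<^bsub>N\<^esub> (b \<odot>\<^bsub>N\<^esub> x)" if "b \<in> carrier R" for b
      by (simp add: transfer x' a that M.smult_assoc1)
    show "a \<odot>\<^bsub>N\<^esub> (x \<oplus>\<^bsub>N\<^esub> y) = a \<odot>\<^bsub>N\<^esub> x \<oplus>\<^bsub>N\<^esub> a \<odot>\<^bsub>N\<^esub> y" if "y \<in> carrier N" for y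
    proof -
      obtain y' where "y' \<in> carrier M" "y = \<phi> y'"
        using surj[OF \<open>y \<in> _\<close>] by blast
      then show ?thesis
        by (simp add: transfer x' a M.smult_r_distr del: hom.hom_add)
    qed
  next
    show "\<one>\<^bsub>R\<^esub> \<odot>\<^bsub>N\<^esub> x = x" if "x \<in> carrier N" for x
      using surj[OF that] by (auto simp flip: smult)
  qed
  interpret N: module R N
    by (rule mod)
  show ?thesis
  proof (intro bigraded_algebra.intro bigraded_algebra_axioms.intro mod N)
    fix a x y assume a: "a \<in> carrier R" and xy: "x \<in> carrier N" "y \<in> carrier N"
    obtain x' y' where x': "x' \<in> carrier M" "x = \<phi> x'" and y': "y' \<in> carrier M" "y = \<phi> y'"
      using surj[OF xy(1)] surj[OF xy(2)] by blast
    note simps = x' y' a smult[symmetric] hom.hom_mult[symmetric]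
    show "(a \<odot>\<^bsub>N\<^esub> x) \<otimes>\<^bsub>N\<^esub> y = a \<odot>\<^bsub>N\<^esub> (x \<otimes>\<^bsub>N\<^esub> y)"
      by (simp add: simps M.smult_mult_left del: hom.hom_mult)
    show "x \<otimes>\<^bsub>N\<^esub> (a \<odot>\<^bsub>N\<^esub> y) = a \<odot>\<^bsub>N\<^esub> (x \<otimes>\<^bsub>N\<^esub> y)"
      by (simp add: simps M.smult_mult_right del: hom.hom_mult)
  next
    fix d
    have "\<phi> x \<oplus>\<^bsub>N\<^esub> \<phi> y \<in> \<phi> ` D d" if "x \<in> D d" "y \<in> D d" for x y
      using that D_carrier[of d] M.submoduleE(5)[OF M.part_submodule, of x d y]
      by (metis hom.hom_add image_eqI subsetD)
    moreover have "\<ominus>\<^bsub>N\<^esub> \<phi> x \<in> \<phi> ` D d" if "x \<in> D d" for x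
      using that D_carrier[of d] M.submoduleE(3)[OF M.part_submodule, of x d]
      by (metis hom.hom_a_inv image_eqI subsetD)
    moreover have "a \<odot>\<^bsub>N\<^esub> \<phi> x \<in> \<phi> ` D d" if "a \<in> carrier R" "x \<in> D d" for a x
      using that D_carrier[of d] M.submoduleE(4)[OF M.part_submodule, of a x d] smult
      by (metis image_eqI subsetD)
    moreover have "\<zero>\<^bsub>N\<^esub> \<in> \<phi> ` D d"
      \<comment> \<open>The unit of the additive group underlying \<open>M\<close> is the zero of
        \<open>M\<close>.\<close>
      using subgroup.one_closed[OF submodule.axioms(1)[OF M.part_submodule[of d]]]
      by (metis zero image_eqI monoid.select_convs(2))
    ultimately show "submodule (E d) R N"
      unfolding parts[symmetric] using D_carrier[of d] by (intro N.submoduleI) auto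
  next
    show "\<one>\<^bsub>N\<^esub> \<in> E (0, 0)"
      unfolding parts[symmetric] using M.one_part hom.hom_one by (metis image_eqI)
    show "x \<otimes>\<^bsub>N\<^esub> y \<in> E (n1 + n2, w1 + w2)" if xy: "x \<in> E (n1, w1)" "y \<in> E (n2, w2)"
        for x y n1 w1 n2 w2
    proof -
      obtain x' y' where x': "x' \<in> D (n1, w1)" "x = \<phi> x'" and y': "y' \<in> D (n2, w2)" "y = \<phi> y'"
        using xy unfolding parts[symmetric] by blast
      have "x' \<in> carrier M" "y' \<in> carrier M"
        using x' y' D_carrier by blast+
      then have "x \<otimes>\<^bsub>N\<^esub> y = \<phi> (x' \<otimes>\<^bsub>M\<^esub> y')"
        by (simp add: x' y')
      then show ?thesis
        unfolding parts[symmetric] using M.mult_part[OF x'(1) y'(1)] by (rule image_eqI)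
    qed
  next
    fix y assume "y \<in> carrier N"
    then obtain x where x: "x \<in> carrier M" "y = \<phi> x"
      using surj by blast
    \<comment> \<open>\<phi> kills only zero, so both index sets of nonzero components
      coincide.\<close>
    have transfer: "\<phi> (finsum M c {d. c d \<noteq> \<zero>\<^bsub>M\<^esub>}) = finsum N (\<lambda>d. \<phi> (c d)) {d. \<phi> (c d) \<noteq> \<zero>\<^bsub>N\<^esub>}"
      if "\<And>d. c d \<in> D d" for c
    proof -
      have c: "c d \<in> carrier M" for d
        using that D_carrier by blast
      then show ?thesis
        by (subst hom.hom_finsum) (auto simp: zero_iff comp_def)
    qed
    obtain c where c: "\<And>d. c d \<in> D d" "finite {d. c d \<noteq> \<zero>\<^bsub>M\<^esub>}"
        "x = finsum M c {d. c d \<noteq> \<zero>\<^bsub>M\<^esub>}"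
      and unique: "\<And>c'. (\<forall>d. c' d \<in> D d) \<and> finite {d. c' d \<noteq> \<zero>\<^bsub>M\<^esub>} \<and>
        x = finsum M c' {d. c' d \<noteq> \<zero>\<^bsub>M\<^esub>} \<Longrightarrow> c' = c"
      using M.parts_direct_sum[OF x(1)] by (elim ex1E) blast
    have c_carrier: "c d \<in> carrier M" for d
      using c(1) D_carrier by blast
    show "\<exists>!c. (\<forall>d. c d \<in> E d) \<and> finite {d. c d \<noteq> \<zero>\<^bsub>N\<^esub>} \<and> y = finsum N c {d. c d \<noteq> \<zero>\<^bsub>N\<^esub>}"
    proof (rule ex1I)
      have "y = finsum N (\<lambda>d. \<phi> (c d)) {d. \<phi> (c d) \<noteq> \<zero>\<^bsub>N\<^esub>}"
        using transfer[OF c(1)] x(2) c(3) by simp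
      then show "(\<forall>d. \<phi> (c d) \<in> E d) \<and> finite {d. \<phi> (c d) \<noteq> \<zero>\<^bsub>N\<^esub>} \<and>
          y = finsum N (\<lambda>d. \<phi> (c d)) {d. \<phi> (c d) \<noteq> \<zero>\<^bsub>N\<^esub>}"
        unfolding parts[symmetric] using c(1,2) by (simp add: zero_iff c_carrier)
      fix c'
      assume c': "(\<forall>d. c' d \<in> E d) \<and> finite {d. c' d \<noteq> \<zero>\<^bsub>N\<^esub>} \<and> y = finsum N c' {d. c' d \<noteq> \<zero>\<^bsub>N\<^esub>}"
      \<comment> \<open>A rival decomposition lifts component by component to \<open>M\<close>,
        where uniqueness is known.\<close>
      then have "\<forall>d. \<exists>z\<in>D d. c' d = \<phi> z"
        unfolding parts[symmetric] by blast
      then obtain b where b: "\<And>d. b d \<in> D d" "\<And>d. c' d = \<phi> (b d)"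
        by metis
      have b_carrier: "b d \<in> carrier M" for d
        using b(1) D_carrier by blast
      have fin: "finite {d. b d \<noteq> \<zero>\<^bsub>M\<^esub>}"
        using c' by (simp add: b(2) zero_iff b_carrier)
      have "c' = (\<lambda>d. \<phi> (b d))"
        using b(2) by blast
      then have "\<phi> x = \<phi> (finsum M b {d. b d \<noteq> \<zero>\<^bsub>M\<^esub>})"
        using c' x(2) transfer[OF b(1)] by simp
      then have "x = finsum M b {d. b d \<noteq> \<zero>\<^bsub>M\<^esub>}"
        by (subst (asm) inj) (use x(1) b_carrier in auto)
      with unique[of b] b(1) fin have "b = c"
        by blast
      then show "c' = (\<lambda>d. \<phi> (c d))"
        using b(2) by blast
    qed
  qed
qed


section \<open>Substitution and symmetrized monomials\<close>

lemma additive_mconst_mult: "Modules.additive (\<lambda>c. mconst c * p)"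
  by (rule additive.intro) (simp add: mconst_def single_add distrib_right)

lemma additive_msubst: "Modules.additive (msubst g)"
  unfolding msubst_def by (rule additive_sum_keys) (rule additive_mconst_mult)

lemma msubst_single:
  "msubst g (Poly_Mapping.single e c) = mconst c * (\<Prod>i\<in>Poly_Mapping.keys e.
      g i ^ Poly_Mapping.lookup e i)"
  by (simp add: msubst_def mconst_zero)

text \<open>All three products can be taken over the union of the supports: a variable outside a
  support has exponent 0 and contributes a factor 1.\<close>

lemma prod_power_keys_add:
  fixes g :: "nat \<Rightarrow> 'a::comm_ring_1 mpoly"
  shows "(\<Prod>i\<in>Poly_Mapping.keys (e + e'). g i ^ Poly_Mapping.lookup (e + e') i) =
    (\<Prod>i\<in>Poly_Mapping.keys e. g i ^ Poly_Mapping.lookup e i) * (\<Prod>i\<in>Poly_Mapping.keys e'.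
        g i ^ Poly_Mapping.lookup e' i)"
proof -
  let ?S = "Poly_Mapping.keys e \<union> Poly_Mapping.keys e'"
  have *: "(\<Prod>i\<in>Poly_Mapping.keys d. g i ^ Poly_Mapping.lookup d i) =
      (\<Prod>i\<in>?S. g i ^ Poly_Mapping.lookup d i)"
    if "Poly_Mapping.keys d \<subseteq> ?S" for d
    by (rule prod.mono_neutral_left) (use that in \<open>auto simp: in_keys_iff\<close>)
  show ?thesis
    using *[OF keys_add] *[of e] *[of e'] by (simp add: lookup_add power_add prod.distrib)
qed

lemma mconst_mult_mconst: "mconst a * mconst b = mconst (a * b)"
  by (simp add: mconst_def mult_single)

lemma mconst_one: "mconst 1 = 1"
  by (simp add: mconst_def)

text \<open>Both sides are additive in \<open>p\<close> and in \<open>r\<close>, so monomials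
  suffice, where exponents simply add.\<close>

lemma msubst_mult: "msubst g (p * r) = msubst g p * msubst g r"
proof (rule additive_ext[where f = p and F = "\<lambda>p. msubst g (p * r)"
      and G = "\<lambda>p. msubst g p * msubst g r"])
  show "Modules.additive (\<lambda>p. msubst g (p * r))"
    by (intro additive_compose[OF additive_msubst] additive_times')
  show "Modules.additive (\<lambda>p. msubst g p * msubst g r)"
    by (intro additive_compose[OF additive_times'] additive_msubst)
  show "msubst g (Poly_Mapping.single e c * r) = msubst g (Poly_Mapping.single e c) * msubst g r"
      for e c
  proof (rule additive_ext[where f = r and F = "\<lambda>r. msubst g (Poly_Mapping.single e c * r)"
        and G = "\<lambda>r. msubst g (Poly_Mapping.single e c) * msubst g r"])
    show "Modules.additive (\<lambda>r. msubst g (Poly_Mapping.single e c * r))"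
      by (intro additive_compose[OF additive_msubst] additive_times)
    show "Modules.additive (\<lambda>r. msubst g (Poly_Mapping.single e c) * msubst g r)"
      by (intro additive_compose[OF additive_times] additive_msubst)
    show "msubst g (Poly_Mapping.single e c * Poly_Mapping.single e' c') =
        msubst g (Poly_Mapping.single e c) * msubst g (Poly_Mapping.single e' c')"
      for e' c'
      by (simp add: mult_single msubst_single prod_power_keys_add mult_ac flip: mconst_mult_mconst)
  qed
qed

lemma msubst_one: "msubst g 1 = 1"
  using msubst_single[of g 0 1] by (simp add: mconst_one)

lemma msubst_power: "msubst g (p ^ n) = msubst g p ^ n"
  by (induction n) (simp_all add: msubst_one msubst_mult)

lemma msubst_prod: "msubst g (prod F S) = (\<Prod>x\<in>S. msubst g (F x))"
  by (induction S rule: infinite_finite_induct) (simp_all add: msubst_one msubst_mult)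

lemma msubst_mvar: "msubst g (mvar i) = g i"
  by (simp add: mvar_def msubst_single mconst_one)

section \<open>Monomials and their exponent vectors\<close>

lemma mvar_power: "mvar i ^ n = Poly_Mapping.single (Poly_Mapping.single i n) 1"
  by (induction n) (simp_all add: mvar_def mult_single flip: single_add)

lemma prod_mvar_power:
  "finite S \<Longrightarrow> (\<Prod>i\<in>S. mvar (s i) ^ a i) =
      Poly_Mapping.single (\<Sum>i\<in>S. Poly_Mapping.single (s i) (a i)) 1"
proof (induction S rule: finite_induct)
  case (insert x S)
  then show ?case
    by (simp add: mvar_power mult_single)
qed simp

text \<open>In this form supports, degrees and coefficients of \<open>P lam\<close> can be read
  off.\<close>

lemma P_eq_sum_single:
  "P lam = (\<Sum>\<sigma> | \<sigma> permutes {..<length lam}.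
    Poly_Mapping.single (\<Sum>i<length lam. Poly_Mapping.single (\<sigma> i) (lam ! i)) 1)"
  by (simp add: P_def prod_mvar_power)

lemma mconst_mult_P:
  "mconst c * P lam = (\<Sum>\<sigma> | \<sigma> permutes {..<length lam}.
    Poly_Mapping.single (\<Sum>i<length lam. Poly_Mapping.single (\<sigma> i) (lam ! i)) c)"
  by (simp add: P_eq_sum_single sum_distrib_left mconst_def mult_single)

lemma msubst_P:
  "msubst g (P lam) =
    (\<Sum>\<sigma> | \<sigma> permutes {..<length lam}. \<Prod>i<length lam. g (\<sigma> i) ^ (lam ! i))"
  by (simp add: P_def additive.sum[OF additive_msubst] msubst_prod msubst_power msubst_mvar)

text \<open>Injectivity of \<sigma> leaves only one summand that meets position \<sigma> i.\<close>

lemma lookup_monomial_exponent: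
  fixes a :: "nat \<Rightarrow> nat"
  assumes "\<sigma> permutes {..<n}" "i < n"
  shows "Poly_Mapping.lookup (\<Sum>i<n. Poly_Mapping.single (\<sigma> i) (a i)) (\<sigma> i) = a i"
proof -
  have "Poly_Mapping.lookup (\<Sum>i<n. Poly_Mapping.single (\<sigma> i) (a i)) (\<sigma> i) =
      (\<Sum>k<n. if k = i then a k else 0)"
    using permutes_inj[OF assms(1)]
    by (simp add: lookup_sum lookup_single when_def inj_eq)
  then show ?thesis
    using assms(2) by simp
qed

lemma keys_monomial_exponent:
  assumes "\<sigma> permutes {..<n}"
  shows "Poly_Mapping.keys (\<Sum>i<n. Poly_Mapping.single (\<sigma> i) (a i)) \<subseteq> {..<n}"
proof
  fix j assume "j \<in> Poly_Mapping.keys (\<Sum>i<n. Poly_Mapping.single (\<sigma> i) (a i))"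
  then have "(\<Sum>i<n. Poly_Mapping.lookup (Poly_Mapping.single (\<sigma> i) (a i)) j) \<noteq> 0"
    unfolding in_keys_iff lookup_sum .
  then obtain i where "i \<in> {..<n}" "Poly_Mapping.lookup (Poly_Mapping.single (\<sigma> i) (a i)) j \<noteq> 0"
    by (rule sum.not_neutral_contains_not_neutral)
  then show "j \<in> {..<n}"
    using permutes_in_image[OF assms, of i] by (auto simp: lookup_single when_def split: if_splits)
qed

lemma monom_degree_monomial_exponent:
  assumes "\<sigma> permutes {..<n}"
  shows "monom_degree (\<Sum>i<n. Poly_Mapping.single (\<sigma> i) (a i)) = (\<Sum>i<n. a i)"
proof -
  let ?e = "\<Sum>i<n. Poly_Mapping.single (\<sigma> i) (a i)"
  \<comment> \<open>Summing over all \<open>n\<close> positions instead of the support makes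
    reindexing by \<sigma> possible.\<close>
  have "monom_degree ?e = (\<Sum>j<n. Poly_Mapping.lookup ?e j)"
    unfolding monom_degree_def
    by (rule sum.mono_neutral_left) (use keys_monomial_exponent[OF assms] in \<open>auto simp:
        in_keys_iff\<close>)
  also have "\<dots> = (\<Sum>i<n. Poly_Mapping.lookup ?e (\<sigma> i))"
    by (rule sum.reindex_bij_betw[OF permutes_imp_bij[OF assms], symmetric])
  also have "\<dots> = (\<Sum>i<n. a i)"
    using lookup_monomial_exponent[OF assms] by simp
  finally show ?thesis .
qed

section \<open>Symmetries of the polynomials P\<close>

lemma sort_eq_sort_iff: "sort xs = sort ys \<longleftrightarrow> mset xs = mset ys"
  by (metis mset_sort sorted_list_of_multiset_mset)

text \<open>A reordering \<pi> of the parts is absorbed by right translation of the symmetric group.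
  Hence \<open>P\<close> may be evaluated on unsorted lists, such as concatenations and exponent
  lists.\<close>

lemma P_cong_mset:
  assumes "mset xs = mset ys"
  shows "P xs = P ys"
proof -
  obtain \<pi> where \<pi>: "\<pi> permutes {..<length ys}" "permute_list \<pi> ys = xs"
    using assms by (rule mset_eq_permutation)
  define n where "n = length ys"
  have len: "length xs = n"
    using mset_eq_length[OF assms] by (simp add: n_def)
  have "P ys = (\<Sum>\<sigma> | \<sigma> permutes {..<n}. \<Prod>i<n. mvar (\<sigma> i) ^ (ys ! i))"
    by (simp add: P_def n_def)
  also have "\<dots> = (\<Sum>\<sigma> | \<sigma> permutes {..<n}. \<Prod>i<n. mvar (\<sigma> (\<pi> i)) ^ (ys ! \<pi> i))"
    by (intro sum.cong refl prod.reindex_bij_betw[symmetric] permutes_imp_bij)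
       (use \<pi> in \<open>simp add: n_def\<close>)
  also have "\<dots> = (\<Sum>\<sigma> | \<sigma> permutes {..<n}. \<Prod>i<n. mvar ((\<sigma> \<circ> \<pi>) i) ^ (xs ! i))"
    using \<pi> by (auto simp: n_def permute_list_nth intro!: sum.cong prod.cong)
  also have "\<dots> = P xs"
    unfolding P_def len
    by (rule sum_permutations_compose_right[symmetric]) (use \<pi> in \<open>simp add: n_def\<close>)
  finally show ?thesis ..
qed

text \<open>Permuting the variables by \<tau> is left translation of the summation index.\<close>

lemma P_in_sym_polys: "P lam \<in> sym_polys (length lam)"
proof -
  let ?n = "length lam"
  have "msubst (\<lambda>i. mvar (\<tau> i)) (P lam) = P lam" if "\<tau> permutes {..<?n}" for \<tau>
    unfolding msubst_P
    using setum_permutations_compose_left[OF that, of "\<lambda>\<sigma>. \<Prod>i<?n.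
        mvar (\<sigma> i) ^ (lam ! i)", symmetric]
    by (simp add: P_def)
  moreover have "Poly_Mapping.keys e \<subseteq> {..<?n}" if e: "e \<in> Poly_Mapping.keys (P lam)" for e
  proof -
    have "(\<Sum>\<sigma> | \<sigma> permutes {..<?n}. Poly_Mapping.lookup (Poly_Mapping.single (\<Sum>i<?n.
        Poly_Mapping.single (\<sigma> i) (lam ! i)) 1) e) \<noteq> (0::rat)"
      using e unfolding P_eq_sum_single in_keys_iff lookup_sum .
    then obtain \<sigma> where "\<sigma> \<in> {\<sigma>. \<sigma> permutes {..<?n}}"
      "Poly_Mapping.lookup (Poly_Mapping.single (\<Sum>i<?n. Poly_Mapping.single (\<sigma> i) (lam ! i)) 1) e \<noteq>
          (0::rat)"
      by (rule sum.not_neutral_contains_not_neutral)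
    then show ?thesis
      using keys_monomial_exponent[of \<sigma> ?n "(!) lam"]
      by (auto simp: lookup_single when_def split: if_splits)
  qed
  ultimately show ?thesis
    by (simp add: sym_polys_def)
qed

lemma sym_polys_add: "f \<in> sym_polys n \<Longrightarrow> g \<in> sym_polys n \<Longrightarrow> f + g \<in> sym_polys n"
  using keys_add[of f g] by (simp add: sym_polys_def additive.add[OF additive_msubst]) blast

lemma sym_polys_zero: "0 \<in> sym_polys n"
  by (simp add: sym_polys_def additive.zero[OF additive_msubst])

lemma sym_polys_mconst_mult: "f \<in> sym_polys n \<Longrightarrow> mconst c * f \<in> sym_polys n"
  by (auto simp: sym_polys_def msubst_mconst_mult in_keys_iff lookup_mconst_mult)


section \<open>Shuffles\<close>

text \<open>The block permutation (\<sigma>, \<tau>) followed by the shuffle that maps the first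
  block increasingly onto \<open>I\<close> and the second onto its complement: the decomposition of
  the symmetric group into cosets of a Young subgroup. Positions outside both blocks are fixed, as
  \<open>permutes\<close> demands.\<close>

definition shuffle_perm ::
  "nat \<Rightarrow> nat \<Rightarrow> nat set \<Rightarrow> (nat \<Rightarrow> nat) \<Rightarrow> (nat \<Rightarrow> nat) \<Rightarrow> nat \<Rightarrow> nat" where
  "shuffle_perm n1 n2 I \<sigma> \<tau> t =
    (if t < n1 then sorted_list_of_set I ! \<sigma> t
     else if t < n1 + n2 then sorted_list_of_set ({..<n1 + n2} - I) ! \<tau> (t - n1)
     else t)"

lemma bij_betw_nth_sorted_list_of_set:
  "finite S \<Longrightarrow> card S = n \<Longrightarrow> bij_betw ((!) (sorted_list_of_set S)) {..<n} S"
  by (rule bij_betw_nth) auto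

text \<open>Besides bijectivity, this recovers \<open>I\<close> as the image of the first
  block.\<close>

lemma bij_betw_shuffle_perm_left:
  assumes "I \<subseteq> {..<n1 + n2}" "card I = n1" "\<sigma> permutes {..<n1}"
  shows "bij_betw (shuffle_perm n1 n2 I \<sigma> \<tau>) {..<n1} I"
proof -
  have "bij_betw ((!) (sorted_list_of_set I) \<circ> \<sigma>) {..<n1} I"
    using assms
    by (intro bij_betw_trans[OF permutes_imp_bij bij_betw_nth_sorted_list_of_set])
       (auto intro: finite_subset)
  then show ?thesis
    by (rule bij_betw_cong[THEN iffD1, rotated]) (simp add: shuffle_perm_def)
qed

lemma bij_betw_shuffle_perm_right:
  assumes "I \<subseteq> {..<n1 + n2}" "card I = n1" "\<tau> permutes {..<n2}"
  shows "bij_betw (shuffle_perm n1 n2 I \<sigma> \<tau>) {n1..<n1 + n2} ({..<n1 + n2} - I)"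
proof -
  have "finite I" using assms(1) finite_subset by blast
  then have "card ({..<n1 + n2} - I) = n2"
    using assms by (simp add: card_Diff_subset)
  moreover have "bij_betw (\<lambda>t. t - n1) {n1..<n1 + n2} {..<n2}"
    by (rule bij_betw_byWitness[where f' = "\<lambda>t. t + n1"]) auto
  ultimately have "bij_betw ((!) (sorted_list_of_set ({..<n1 + n2} - I)) \<circ> (\<tau> \<circ> (\<lambda>t. t - n1)))
      {n1..<n1 + n2} ({..<n1 + n2} - I)"
    using assms(3)
    by (intro bij_betw_trans[OF bij_betw_trans[OF _ permutes_imp_bij]
        bij_betw_nth_sorted_list_of_set])
       auto
  then show ?thesis
    by (rule bij_betw_cong[THEN iffD1, rotated]) (simp add: shuffle_perm_def)
qed

lemma shuffle_perm_permutes: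
  assumes "I \<subseteq> {..<n1 + n2}" "card I = n1" "\<sigma> permutes {..<n1}" "\<tau> permutes {..<n2}"
  shows "shuffle_perm n1 n2 I \<sigma> \<tau> permutes {..<n1 + n2}"
proof (rule bij_imp_permutes)
  have "bij_betw (shuffle_perm n1 n2 I \<sigma> \<tau>) ({..<n1} \<union> {n1..<n1 + n2}) (I \<union> ({..<n1 + n2} - I))"
    using assms
    by (intro bij_betw_combine bij_betw_shuffle_perm_left bij_betw_shuffle_perm_right) auto
  moreover have "{..<n1} \<union> {n1..<n1 + n2} = {..<n1 + n2}" "I \<union> ({..<n1 + n2} - I) = {..<n1 + n2}"
    using assms(1) by auto
  ultimately show "bij_betw (shuffle_perm n1 n2 I \<sigma> \<tau>) {..<n1 + n2} {..<n1 + n2}"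
    by simp
qed (simp add: shuffle_perm_def)

text \<open>Injectivity is shown directly; surjectivity then follows by counting, since the number
  of subsets times n1! n2! is (n1 + n2)!.\<close>

lemma bij_betw_shuffle_perm:
  "bij_betw (\<lambda>(I, \<sigma>, \<tau>). shuffle_perm n1 n2 I \<sigma> \<tau>)
    ({I. I \<subseteq> {..<n1 + n2} \<and> card I = n1} \<times> {\<sigma>. \<sigma> permutes {..<n1}} \<times> {\<tau>. \<tau> permutes {..<n2}})
    {\<rho>. \<rho> permutes {..<n1 + n2}}" (is "bij_betw ?F ?D ?R")
proof -
  have *: "I = I' \<and> \<sigma> = \<sigma>' \<and> \<tau> = \<tau>'"
    if I: "I \<subseteq> {..<n1 + n2}" "card I = n1" and \<sigma>: "\<sigma> permutes {..<n1}" and \<tau>: "\<tau> permutes {..<n2}"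
      and I': "I' \<subseteq> {..<n1 + n2}" "card I' = n1"
      and \<sigma>': "\<sigma>' permutes {..<n1}" and \<tau>': "\<tau>' permutes {..<n2}"
      and eq: "shuffle_perm n1 n2 I \<sigma> \<tau> = shuffle_perm n1 n2 I' \<sigma>' \<tau>'"
    for I \<sigma> \<tau> I' \<sigma>' \<tau>'
  proof -
    have "I = shuffle_perm n1 n2 I \<sigma> \<tau> ` {..<n1}"
      using bij_betw_shuffle_perm_left[OF I \<sigma>] by (simp add: bij_betw_def)
    also have "\<dots> = I'"
      using bij_betw_shuffle_perm_left[OF I' \<sigma>'] by (simp add: eq bij_betw_def)
    finally have II': "I = I'" .
    have inj1: "inj_on ((!) (sorted_list_of_set I)) {..<n1}"
      using bij_betw_nth_sorted_list_of_set[of I n1] I finite_subset by (auto simp: bij_betw_def)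
    have "card ({..<n1 + n2} - I) = n2"
      using I finite_subset[OF I(1)] by (simp add: card_Diff_subset)
    then have inj2: "inj_on ((!) (sorted_list_of_set ({..<n1 + n2} - I))) {..<n2}"
      using bij_betw_nth_sorted_list_of_set[of "{..<n1 + n2} - I" n2] by (simp add: bij_betw_def)
    \<comment> \<open>With \<open>I\<close> known, the enumeration of \<open>I\<close> is a common
      injective outer map and can be cancelled; likewise below for the complement and
      \<tau>.\<close>
    have "\<sigma> t = \<sigma>' t" if "t < n1" for t
      using fun_cong[OF eq, of t] that II' inj1 permutes_in_image[OF \<sigma>, of t]
        permutes_in_image[OF \<sigma>', of t]
      by (auto simp: shuffle_perm_def inj_on_def)
    moreover have "\<tau> t = \<tau>' t" if "t < n2" for t
      using fun_cong[OF eq, of "t + n1"] that II' inj2 permutes_in_image[OF \<tau>, of t]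
        permutes_in_image[OF \<tau>', of t]
      by (auto simp: shuffle_perm_def inj_on_def)
    ultimately show ?thesis
      using II' permutes_not_in[OF \<sigma>] permutes_not_in[OF \<sigma>'] permutes_not_in[OF \<tau>]
        permutes_not_in[OF \<tau>']
      by (metis ext lessThan_iff)
  qed
  have inj: "inj_on ?F ?D"
  proof (rule inj_onI)
    fix x y assume xy: "x \<in> ?D" "y \<in> ?D" "?F x = ?F y"
    obtain I \<sigma> \<tau> I' \<sigma>' \<tau>' where "x = (I, \<sigma>, \<tau>)" "y = (I', \<sigma>', \<tau>')"
      by (cases x, cases y) auto
    with xy show "x = y"
      using *[of I \<sigma> \<tau> I' \<sigma>' \<tau>'] by simp
  qed
  have card: "card ?D = card ?R"
    using binomial_fact_lemma[of n1 "n1 + n2"]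
    by (simp add: card_cartesian_product n_subsets card_permutations mult_ac)
  have sub: "?F ` ?D \<subseteq> ?R"
    using shuffle_perm_permutes by auto
  have fin: "finite ?R"
    by (simp add: finite_permutations)
  have "?F ` ?D = ?R"
    by (rule card_subset_eq[OF fin sub trans[OF card_image[OF inj] card]])
  with inj show ?thesis
    by (simp add: bij_betw_def)
qed

lemma sum_permutes_shuffle:
  "(\<Sum>\<rho> | \<rho> permutes {..<n1 + n2}. F \<rho>) =
    (\<Sum>I | I \<subseteq> {..<n1 + n2} \<and> card I = n1. \<Sum>\<sigma> | \<sigma> permutes {..<n1}. \<Sum>\<tau> | \<tau> permutes {..<n2}.
      F (shuffle_perm n1 n2 I \<sigma> \<tau>))"
  unfolding sum.reindex_bij_betw[OF bij_betw_shuffle_perm, symmetric]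
  by (simp add: sum.cartesian_product split_def)

section \<open>Bilinearity of the shuffle product and its values on the P\<close>

lemma additive_shuffle_mult_left: "Modules.additive (\<lambda>f. shuffle_mult m q n1 n2 f g)"
  by (rule additive.intro)
     (simp add: shuffle_mult_def Let_def additive.add[OF additive_msubst] distrib_right sum.distrib)

lemma additive_shuffle_mult_right: "Modules.additive (shuffle_mult m q n1 n2 f)"
  by (rule additive.intro)
     (simp add: shuffle_mult_def Let_def additive.add[OF additive_msubst] distrib_right distrib_left
        sum.distrib)

lemma shuffle_mult_mconst:
  "shuffle_mult m q n1 n2 (mconst a * f) (mconst b * g) =
      mconst (a * b) * shuffle_mult m q n1 n2 f g"
  by (simp add: shuffle_mult_def Let_def msubst_mconst_mult sum_distrib_left
      flip: mconst_mult_mconst) (simp only: mult_ac)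

lemma length_part_mult: "length (part_mult m \<mu> \<nu>) = length \<mu> + length \<nu>"
  by (simp add: part_mult_def part_union_def part_shift_def)

lemma prod_atLeastLessThan_add:
  fixes F :: "nat \<Rightarrow> 'a::comm_monoid_mult"
  shows "(\<Prod>t<n1 + n2. F t) = (\<Prod>t<n1. F t) * (\<Prod>l<n2. F (n1 + l))"
  by (induction n2) (simp_all add: mult_ac)

text \<open>
  At \<open>q = 0\<close> the kernel of the shuffle product only raises the exponent of each variable of the
  second factor by \<open>(m - 1) n\<^sub>1\<close>, so a summand of the product is a sum over pairs of permutations.
\<close>

lemma shuffle_mult_P:
  "shuffle_mult m 0 (length \<mu>) (length \<nu>) (P \<mu>) (P \<nu>) = P (part_mult m \<mu> \<nu>)"
proof -
  define n1 n2 where "n1 = length \<mu>" and "n2 = length \<nu>"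
  define \<nu>' where "\<nu>' = part_shift ((m - 1) * n1) \<nu>"
  \<comment> \<open>Dropping the sort makes the positions split into a block for \<mu> and a block
    for the shifted \<nu>.\<close>
  have "P (part_mult m \<mu> \<nu>) = P (\<mu> @ \<nu>')"
    by (rule P_cong_mset) (simp add: part_mult_def part_union_def \<nu>'_def n1_def)
  also have "\<dots> = (\<Sum>\<rho> | \<rho> permutes {..<n1 + n2}. \<Prod>t<n1 + n2. mvar (\<rho> t) ^ ((\<mu> @ \<nu>') ! t))"
    by (simp add: P_def \<nu>'_def part_shift_def n1_def n2_def)
  also have "\<dots> = (\<Sum>I | I \<subseteq> {..<n1 + n2} \<and> card I = n1.
      \<Sum>\<sigma> | \<sigma> permutes {..<n1}. \<Sum>\<tau> | \<tau> permutes {..<n2}.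
        (\<Prod>k<n1. mvar (sorted_list_of_set I ! \<sigma> k) ^ (\<mu> ! k)) *
        (\<Prod>l<n2. mvar (sorted_list_of_set ({..<n1 + n2} - I) ! \<tau> l) ^ (\<nu> ! l + (m - 1) * n1)))"
    unfolding sum_permutes_shuffle prod_atLeastLessThan_add
    by (intro sum.cong refl arg_cong2[where f = "(*)"] prod.cong)
       (simp_all add: shuffle_perm_def nth_append n1_def n2_def \<nu>'_def part_shift_def)
  also have "\<dots> = shuffle_mult m 0 n1 n2 (P \<mu>) (P \<nu>)"
    unfolding shuffle_mult_def Let_def
  proof (rule sum.cong[OF refl])
    fix I assume "I \<in> {I. I \<subseteq> {..<n1 + n2} \<and> card I = n1}"
    let ?i = "\<lambda>k. sorted_list_of_set I ! k"
    let ?j = "\<lambda>l. sorted_list_of_set ({..<n1 + n2} - I) ! l"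
    let ?K = "(\<Prod>k<n1. \<Prod>l<n2. mvar (?j l) - mconst 0 * mvar (?i k)) ^ (m - 1) :: rat mpoly"
    \<comment> \<open>The kernel is symmetric in the variables of the second factor, so it may be
      rewritten along any \<tau> and its powers merge with those of that summand, although its value
      does not depend on \<tau>.\<close>
    have K: "?K = (\<Prod>l<n2. mvar (?j (\<tau> l)) ^ ((m - 1) * n1))" if "\<tau> permutes {..<n2}" for \<tau>
    proof -
      have "?K = (\<Prod>l<n2. mvar (?j l) ^ ((m - 1) * n1))"
        by (simp add: mconst_zero prod_power_distrib mult.commute flip: power_mult)
      also have "\<dots> = (\<Prod>l<n2. mvar (?j (\<tau> l)) ^ ((m - 1) * n1))"
        by (rule prod.reindex_bij_betw[OF permutes_imp_bij[OF that], symmetric])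
      finally show ?thesis .
    qed
    have "(\<Prod>l<n2. mvar (?j (\<tau> l)) ^ (\<nu> ! l + (m - 1) * n1)) =
        (\<Prod>l<n2. mvar (?j (\<tau> l)) ^ (\<nu> ! l)) * ?K" if "\<tau> permutes {..<n2}" for \<tau>
      unfolding K[OF that] by (simp only: power_add prod.distrib)
    then have "(\<Sum>\<sigma> | \<sigma> permutes {..<n1}. \<Sum>\<tau> | \<tau> permutes {..<n2}.
        (\<Prod>k<n1. mvar (?i (\<sigma> k)) ^ (\<mu> ! k)) *
        (\<Prod>l<n2. mvar (?j (\<tau> l)) ^ (\<nu> ! l + (m - 1) * n1))) =
      (\<Sum>\<sigma> | \<sigma> permutes {..<n1}. \<Sum>\<tau> | \<tau> permutes {..<n2}.
        (\<Prod>k<n1. mvar (?i (\<sigma> k)) ^ (\<mu> ! k)) * ((\<Prod>l<n2. mvar (?j (\<tau> l)) ^ (\<nu> ! l)) * ?K))"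
      by (intro sum.cong refl) simp
    also have "\<dots> = msubst (\<lambda>k. mvar (?i k)) (P \<mu>) * msubst (\<lambda>l. mvar (?j l)) (P \<nu>) * ?K"
      unfolding msubst_P sum_product
      by (simp only: sum_distrib_left sum_distrib_right mult.assoc flip: n1_def n2_def)
    finally show "(\<Sum>\<sigma> | \<sigma> permutes {..<n1}. \<Sum>\<tau> | \<tau> permutes {..<n2}.
        (\<Prod>k<n1. mvar (?i (\<sigma> k)) ^ (\<mu> ! k)) *
        (\<Prod>l<n2. mvar (?j (\<tau> l)) ^ (\<nu> ! l + (m - 1) * n1))) =
      msubst (\<lambda>k. mvar (?i k)) (P \<mu>) * msubst (\<lambda>l. mvar (?j l)) (P \<nu>) * ?K" .
  qed
  finally show ?thesis
    by (simp add: n1_def n2_def)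
qed


section \<open>The algebra \<open>A\<close>\<close>

interpretation A: biadditive
  "\<lambda>\<mu> \<nu> c d. Poly_Mapping.single (part_mult m \<mu> \<nu>) (c * d :: rat)" for m
  by unfold_locales (simp_all add: additive_def distrib_left distrib_right single_add)

interpretation H: biadditive
  "\<lambda>n1 n2 f g. Poly_Mapping.single (n1 + n2) (shuffle_mult m 0 n1 n2 f g :: rat mpoly)" for m
  by unfold_locales
     (simp_all add: additive_def single_add additive.add[OF additive_shuffle_mult_left]
        additive.add[OF additive_shuffle_mult_right])

lemma A_alg_simps:
  "carrier (A_alg m) = {f. Poly_Mapping.keys f \<subseteq> partitions}"
  "f \<otimes>\<^bsub>A_alg m\<^esub> g = A.ext m f g"
  "\<one>\<^bsub>A_alg m\<^esub> = Poly_Mapping.single [] 1"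
  "\<zero>\<^bsub>A_alg m\<^esub> = 0"
  "f \<oplus>\<^bsub>A_alg m\<^esub> g = f + g"
  "c \<odot>\<^bsub>A_alg m\<^esub> f = Poly_Mapping.map ((*) c) f"
  by (simp_all add: A_alg_def A.ext_def)

lemma H_0_simps:
  "carrier (H_0 m) = {f. \<forall>n. Poly_Mapping.lookup f n \<in> sym_polys n}"
  "f \<otimes>\<^bsub>H_0 m\<^esub> g = H.ext m f g"
  "\<one>\<^bsub>H_0 m\<^esub> = Poly_Mapping.single 0 1"
  "\<zero>\<^bsub>H_0 m\<^esub> = 0"
  "f \<oplus>\<^bsub>H_0 m\<^esub> g = f + g"
  "c \<odot>\<^bsub>H_0 m\<^esub> f = Poly_Mapping.map ((*) (mconst c)) f"
  by (simp_all add: H_0_def coha_def H.ext_def)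

lemma rat_ring_simps:
  "carrier (ring_of_type_algebra :: rat ring) = UNIV"
  "x \<otimes>\<^bsub>ring_of_type_algebra\<^esub> y = (x * y :: rat)"
  "\<one>\<^bsub>ring_of_type_algebra\<^esub> = (1 :: rat)"
  "\<zero>\<^bsub>ring_of_type_algebra\<^esub> = (0 :: rat)"
  "x \<oplus>\<^bsub>ring_of_type_algebra\<^esub> y = (x + y :: rat)"
  by (simp_all add: ring_of_type_algebra_def)

text \<open>Only an inclusion: different pairs can give the same partition and then cancel. It
  yields closure of the carrier and compatibility with the grading.\<close>

lemma A_ext_keys:
  "Poly_Mapping.keys (A.ext m f g) \<subseteq> {part_mult m \<mu> \<nu> | \<mu> \<nu>. \<mu> \<in> Poly_Mapping.keys f \<and>
      \<nu> \<in> Poly_Mapping.keys g}"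
proof
  fix lam assume "lam \<in> Poly_Mapping.keys (A.ext m f g)"
  then have "(\<Sum>\<mu>\<in>Poly_Mapping.keys f. \<Sum>\<nu>\<in>Poly_Mapping.keys g.
      Poly_Mapping.lookup (Poly_Mapping.single (part_mult m \<mu> \<nu>) (Poly_Mapping.lookup f \<mu> *
          Poly_Mapping.lookup g \<nu>)) lam) \<noteq> 0"
    by (simp add: in_keys_iff A.ext_def lookup_sum)
  then obtain \<mu> \<nu> where "\<mu> \<in> Poly_Mapping.keys f" "\<nu> \<in> Poly_Mapping.keys g"
    "Poly_Mapping.lookup (Poly_Mapping.single (part_mult m \<mu> \<nu>) (Poly_Mapping.lookup f \<mu> *
        Poly_Mapping.lookup g \<nu>)) lam \<noteq> 0"
    by (meson sum.neutral)
  then show "lam \<in> {part_mult m \<mu> \<nu> | \<mu> \<nu>. \<mu> \<in> Poly_Mapping.keys f \<and> \<nu> \<in> Poly_Mapping.keys g}"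
    by (auto simp: lookup_single when_def split: if_splits)
qed

section \<open>The product on partitions and its bilinear extension\<close>

lemma part_mult_in_partitions: "part_mult m \<mu> \<nu> \<in> partitions"
  by (simp add: part_mult_def part_union_def partitions_def)

text \<open>Both sides sort the same multiset: \<mu> unshifted, \<nu> shifted by m - 1 times the
  length of \<mu>, and \<rho> by m - 1 times the sum of both lengths.\<close>

lemma part_mult_assoc: "part_mult m (part_mult m \<mu> \<nu>) \<rho> = part_mult m \<mu> (part_mult m \<nu> \<rho>)"
  by (simp add: part_mult_def part_union_def part_shift_def sort_eq_sort_iff add_mult_distrib2
      multiset.map_comp comp_def ac_simps)

lemma part_mult_Nil:
  assumes "lam \<in> partitions"
  shows "part_mult m [] lam = lam" "part_mult m lam [] = lam"
  using assms
  by (simp_all add: part_mult_def part_union_def part_shift_def partitions_def sorted_sort_id)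

lemma add_choose_two: "(a + b) choose 2 = (a choose 2) + (b choose 2) + a * b"
  by (induction b) (simp_all add: numeral_2_eq_2)

text \<open>The shift adds m - 1 times the product of the lengths to the size, which is exactly the
  cross term of the binomial coefficient in \<open>add_choose_two\<close>.\<close>

lemma wt_part_mult:
  assumes "m \<ge> 1"
  shows "wt m (part_mult m \<mu> \<nu>) = wt m \<mu> + wt m \<nu>"
proof -
  have sum_list_sort: "sum_list (sort xs) = sum_list xs" for xs :: "nat list"
    by (metis mset_sort sum_mset_sum_list)
  have "sum_list (map (\<lambda>p. p + N) xs) = sum_list xs + length xs * N" for xs and N :: nat
    by (induction xs) simp_all
  then have "sum_list (part_mult m \<mu> \<nu>) = sum_list \<mu> + sum_list \<nu> + length \<nu> * ((m - 1) * length \<mu>)"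
    by (simp add: part_mult_def part_union_def part_shift_def sum_list_sort)
  \<comment> \<open>Reconciles the truncated \<open>m - 1\<close> in the shift with the integer
    \<open>int m - 1\<close> in the weight.\<close>
  moreover obtain k where "m = Suc k"
    using assms by (cases m) auto
  ultimately show ?thesis
    by (simp add: wt_def length_part_mult add_choose_two algebra_simps)
qed

text \<open>Both sides are additive in each of three arguments; three nested reductions leave
  \<open>part_mult_assoc\<close>.\<close>

lemma A_ext_assoc: "A.ext m (A.ext m f g) h = A.ext m f (A.ext m g h)"
proof (rule additive_ext[where f = f and F = "\<lambda>f. A.ext m (A.ext m f g) h"
      and G = "\<lambda>f. A.ext m f (A.ext m g h)"])
  fix \<mu> a
  show "A.ext m (A.ext m (Poly_Mapping.single \<mu> a) g) h =
      A.ext m (Poly_Mapping.single \<mu> a) (A.ext m g h)"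
  proof (rule additive_ext[where f = g and F = "\<lambda>g. A.ext m (A.ext m (Poly_Mapping.single \<mu> a) g) h"
        and G = "\<lambda>g. A.ext m (Poly_Mapping.single \<mu> a) (A.ext m g h)"])
    fix \<nu> b
    show "A.ext m (A.ext m (Poly_Mapping.single \<mu> a) (Poly_Mapping.single \<nu> b)) h =
        A.ext m (Poly_Mapping.single \<mu> a) (A.ext m (Poly_Mapping.single \<nu> b) h)"
      by (rule additive_ext[where f = h and F =
          "A.ext m (A.ext m (Poly_Mapping.single \<mu> a) (Poly_Mapping.single \<nu> b))"
            and G = "\<lambda>h. A.ext m (Poly_Mapping.single \<mu> a) (A.ext m (Poly_Mapping.single \<nu> b) h)"])
         (simp_all add: A.ext_single part_mult_assoc mult.assoc A.ext_additive_right
             additive_compose)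
  qed (rule additive_compose[OF A.ext_additive_left A.ext_additive_right],
      rule additive_compose[OF A.ext_additive_right A.ext_additive_left])
qed (rule additive_compose[OF A.ext_additive_left A.ext_additive_left], rule A.ext_additive_left)

text \<open>On an unsorted list the unit would act by sorting. This is why
  \<open>additive_ext\<close> asks for agreement only on the keys of the given element.\<close>

lemma A_ext_one:
  assumes "Poly_Mapping.keys f \<subseteq> partitions"
  shows "A.ext m (Poly_Mapping.single [] 1) f = f" "A.ext m f (Poly_Mapping.single [] 1) = f"
proof -
  have id: "Modules.additive (\<lambda>f :: nat list \<Rightarrow>\<^sub>0 rat. f)"
    by (simp add: additive_def)
  show "A.ext m (Poly_Mapping.single [] 1) f = f"
    by (rule additive_ext[where F = "A.ext m (Poly_Mapping.single [] 1)" and G = "\<lambda>f. f"])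
       (use assms part_mult_Nil in \<open>auto simp: A.ext_single A.ext_additive_right id\<close>)
  show "A.ext m f (Poly_Mapping.single [] 1) = f"
    by (rule additive_ext[where F = "\<lambda>f. A.ext m f (Poly_Mapping.single [] 1)" and G = "\<lambda>f. f"])
       (use assms part_mult_Nil in \<open>auto simp: A.ext_single A.ext_additive_left id\<close>)
qed

lemma A_ext_smult:
  "A.ext m (Poly_Mapping.map ((*) c) f) g = Poly_Mapping.map ((*) c) (A.ext m f g)"
  "A.ext m f (Poly_Mapping.map ((*) c) g) = Poly_Mapping.map ((*) c) (A.ext m f g)"
proof -
  have map: "Modules.additive (Poly_Mapping.map ((*) c) :: ('x \<Rightarrow>\<^sub>0 rat) \<Rightarrow> _)"
    by (rule additive_map) (rule additive_times)
  note single = map_single_additive[OF additive_times[of c]]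
  show "A.ext m (Poly_Mapping.map ((*) c) f) g = Poly_Mapping.map ((*) c) (A.ext m f g)"
  proof (rule additive_ext[where f = f and F = "\<lambda>f. A.ext m (Poly_Mapping.map ((*) c) f) g"
        and G = "\<lambda>f. Poly_Mapping.map ((*) c) (A.ext m f g)"])
    fix \<mu> a
    show "A.ext m (Poly_Mapping.map ((*) c) (Poly_Mapping.single \<mu> a)) g =
        Poly_Mapping.map ((*) c) (A.ext m (Poly_Mapping.single \<mu> a) g)"
      unfolding single
      by (rule additive_ext[where f = g and F = "A.ext m (Poly_Mapping.single \<mu> (c * a))"
            and G = "\<lambda>g. Poly_Mapping.map ((*) c) (A.ext m (Poly_Mapping.single \<mu> a) g)"])
         (simp_all only: A.ext_single single mult.assoc A.ext_additive_right
            additive_compose[OF map A.ext_additive_right])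
  qed (rule additive_compose[OF A.ext_additive_left map],
      rule additive_compose[OF map A.ext_additive_left])
  show "A.ext m f (Poly_Mapping.map ((*) c) g) = Poly_Mapping.map ((*) c) (A.ext m f g)"
  proof (rule additive_ext[where f = f and F = "\<lambda>f. A.ext m f (Poly_Mapping.map ((*) c) g)"
        and G = "\<lambda>f. Poly_Mapping.map ((*) c) (A.ext m f g)"])
    fix \<mu> a
    show "A.ext m (Poly_Mapping.single \<mu> a) (Poly_Mapping.map ((*) c) g) =
        Poly_Mapping.map ((*) c) (A.ext m (Poly_Mapping.single \<mu> a) g)"
      by (rule additive_ext[where f = g and F =
          "\<lambda>g. A.ext m (Poly_Mapping.single \<mu> a) (Poly_Mapping.map ((*) c) g)"
            and G = "\<lambda>g. Poly_Mapping.map ((*) c) (A.ext m (Poly_Mapping.single \<mu> a) g)"])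
         (simp_all only: A.ext_single single mult.left_commute
            additive_compose[OF A.ext_additive_right map] additive_compose[OF map
                A.ext_additive_right])
  qed (rule A.ext_additive_left, rule additive_compose[OF map A.ext_additive_left])
qed

section \<open>Module, ring and grading of A\<close>

lemma abelian_group_A: "abelian_group (A_alg m)"
proof (rule abelian_groupI)
  fix f assume "f \<in> carrier (A_alg m)"
  then have "- f \<in> carrier (A_alg m)" "- f \<oplus>\<^bsub>A_alg m\<^esub> f = \<zero>\<^bsub>A_alg m\<^esub>"
    by (auto simp: A_alg_simps in_keys_iff)
  then show "\<exists>g\<in>carrier (A_alg m). g \<oplus>\<^bsub>A_alg m\<^esub> f = \<zero>\<^bsub>A_alg m\<^esub>"
    by blast
qed (use keys_add in \<open>fastforce simp: A_alg_simps add_ac\<close>)+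

lemma ring_A: "ring (A_alg m)"
proof (rule ringI[OF abelian_group_A])
  show "monoid (A_alg m)"
    by (rule monoidI)
       (use A_ext_keys part_mult_in_partitions in
         \<open>auto simp: A_alg_simps A_ext_assoc A_ext_one partitions_def\<close>, fastforce+)
qed (simp_all add: A_alg_simps additive.add[OF A.ext_additive_left] additive.add[OF
    A.ext_additive_right])

lemma module_A: "module (ring_of_type_algebra :: rat ring) (A_alg m)"
proof (rule moduleI[OF _ abelian_group_A])
  show "cring (ring_of_type_algebra :: rat ring)" ..
qed (auto simp: A_alg_simps rat_ring_simps in_keys_iff lookup_map_zero lookup_add algebra_simps
      intro!: poly_mapping_eqI)

text \<open>Lets the direct sum condition be checked coefficient by coefficient.\<close>

lemma finsum_A:
  assumes "finite S" "\<And>x. x \<in> S \<Longrightarrow> F x \<in> carrier (A_alg m)"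
  shows "finsum (A_alg m) F S = sum F S"
proof -
  interpret abelian_group "A_alg m"
    by (rule abelian_group_A)
  show ?thesis
    using assms by (induction S rule: finite_induct) (simp_all add: Pi_def A_alg_simps(4,5))
qed

definition bidegree :: "nat \<Rightarrow> nat list \<Rightarrow> nat \<times> int" where
  "bidegree m lam = (length lam, wt m lam)"

lemma A_part_eq: "A_part m d = {f \<in> carrier (A_alg m). \<forall>lam\<in>Poly_Mapping.keys f.
    bidegree m lam = d}"
  by (cases d) (auto simp: A_part_def bidegree_def)

text \<open>Every basis vector is homogeneous, so the components are the restrictions of
  \<open>f\<close> to the fibres of \<open>bidegree\<close>. They are unique because the coefficient
  at \<open>lam\<close> can only come from the component of degree
  \<open>bidegree m lam\<close>.\<close>

lemma A_parts_direct_sum: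
  assumes f: "f \<in> carrier (A_alg m)"
  shows "\<exists>!c. (\<forall>d. c d \<in> A_part m d) \<and> finite {d. c d \<noteq> \<zero>\<^bsub>A_alg m\<^esub>} \<and>
    f = (\<Oplus>\<^bsub>A_alg m\<^esub>d\<in>{d. c d \<noteq> \<zero>\<^bsub>A_alg m\<^esub>}. c d)"
proof (rule ex1I)
  define c where "c d = (\<Sum>lam | lam \<in> Poly_Mapping.keys f \<and> bidegree m lam = d.
      Poly_Mapping.single lam (Poly_Mapping.lookup f lam))" for d
  have lookup_c: "Poly_Mapping.lookup (c d) lam =
      (if bidegree m lam = d then Poly_Mapping.lookup f lam else 0)" for d lam
    by (auto simp: c_def lookup_sum lookup_single when_def in_keys_iff)
  have c_part: "c d \<in> A_part m d" for d
    using f by (auto simp: A_part_eq A_alg_simps in_keys_iff lookup_c split: if_splits)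
  have "{d. c d \<noteq> 0} \<subseteq> bidegree m ` Poly_Mapping.keys f"
  proof
    fix d assume "d \<in> {d. c d \<noteq> 0}"
    then have "\<exists>lam. Poly_Mapping.lookup (c d) lam \<noteq> 0"
      using poly_mapping_eqI[of "c d" 0] by auto
    then show "d \<in> bidegree m ` Poly_Mapping.keys f"
      by (auto simp: lookup_c in_keys_iff split: if_splits)
  qed
  then have fin: "finite {d. c d \<noteq> 0}"
    by (rule finite_subset) simp
  have "f = (\<Sum>d | c d \<noteq> 0. c d)"
  proof (rule poly_mapping_eqI)
    fix lam
    \<comment> \<open>Covers the case where the degree of \<open>lam\<close> is missing from the
      index set of the sum.\<close>
    have "Poly_Mapping.lookup f lam = 0" if "c (bidegree m lam) = 0"
      using that lookup_c[of "bidegree m lam" lam] by simp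
    then show "Poly_Mapping.lookup f lam = Poly_Mapping.lookup (\<Sum>d | c d \<noteq> 0. c d) lam"
      using fin by (auto simp: lookup_sum lookup_c)
  qed
  also have "\<dots> = finsum (A_alg m) c {d. c d \<noteq> 0}"
    using fin c_part by (intro finsum_A[symmetric]) (auto simp: A_part_eq)
  finally show "(\<forall>d. c d \<in> A_part m d) \<and> finite {d. c d \<noteq> \<zero>\<^bsub>A_alg m\<^esub>} \<and>
      f = (\<Oplus>\<^bsub>A_alg m\<^esub>d\<in>{d. c d \<noteq> \<zero>\<^bsub>A_alg m\<^esub>}. c d)"
    using c_part fin by (simp add: A_alg_simps)
  fix c'
  assume *: "(\<forall>d. c' d \<in> A_part m d) \<and> finite {d. c' d \<noteq> \<zero>\<^bsub>A_alg m\<^esub>} \<and>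
      f = (\<Oplus>\<^bsub>A_alg m\<^esub>d\<in>{d. c' d \<noteq> \<zero>\<^bsub>A_alg m\<^esub>}. c' d)"
  then have fin': "finite {d. c' d \<noteq> 0}"
    by (simp add: A_alg_simps)
  have part': "c' d \<in> A_part m d" for d
    using * by blast
  have "finsum (A_alg m) c' {d. c' d \<noteq> 0} = (\<Sum>d | c' d \<noteq> 0. c' d)"
    using fin' part' by (intro finsum_A) (auto simp: A_part_eq)
  with * have f': "f = (\<Sum>d | c' d \<noteq> 0. c' d)"
    by (simp add: A_alg_simps)
  have other: "Poly_Mapping.lookup (c' d) lam = 0" if "bidegree m lam \<noteq> d" for d lam
    using part'[of d] that by (auto simp: A_part_eq in_keys_iff)
  have "Poly_Mapping.lookup f lam = Poly_Mapping.lookup (c' (bidegree m lam)) lam" for lam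
  proof -
    have "Poly_Mapping.lookup f lam = (\<Sum>d | c' d \<noteq> 0. Poly_Mapping.lookup (c' d) lam)"
      by (subst f') (rule lookup_sum)
    also have "\<dots> = (\<Sum>d | c' d \<noteq> 0.
        if d = bidegree m lam then Poly_Mapping.lookup (c' d) lam else 0)"
      by (intro sum.cong) (auto simp: other)
    also have "\<dots> = Poly_Mapping.lookup (c' (bidegree m lam)) lam"
      using fin' by simp
    finally show ?thesis .
  qed
  then have "Poly_Mapping.lookup (c' d) lam = Poly_Mapping.lookup (c d) lam" for d lam
    using other by (simp add: lookup_c)
  then show "c' = c"
    by (intro ext poly_mapping_eqI)
qed

lemma bigraded_algebra_A:
  assumes "m \<ge> 1"
  shows "bigraded_algebra (ring_of_type_algebra :: rat ring) (A_alg m) (A_part m)"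
proof (intro bigraded_algebra.intro bigraded_algebra_axioms.intro module_A ring_A
    A_parts_direct_sum)
  interpret module "ring_of_type_algebra :: rat ring" "A_alg m"
    by (rule module_A)
  show "submodule (A_part m d) (ring_of_type_algebra :: rat ring) (A_alg m)" for d
  proof (rule submoduleI)
    fix f assume f: "f \<in> A_part m d"
    then have "- f \<oplus>\<^bsub>A_alg m\<^esub> f = \<zero>\<^bsub>A_alg m\<^esub>" "f \<in> carrier (A_alg m)" "- f \<in> carrier (A_alg m)"
      by (auto simp: A_part_eq A_alg_simps in_keys_iff)
    \<comment> \<open>The inverse inside the record is identified with \<open>- f\<close> by
      uniqueness of inverses.\<close>
    then have "\<ominus>\<^bsub>A_alg m\<^esub> f = - f"
      using M.minus_equality by blast
    with f show "\<ominus>\<^bsub>A_alg m\<^esub> f \<in> A_part m d"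
      by (auto simp: A_part_eq A_alg_simps in_keys_iff)
  next
    fix f g assume "f \<in> A_part m d" "g \<in> A_part m d"
    with keys_add[of f g] show "f \<oplus>\<^bsub>A_alg m\<^esub> g \<in> A_part m d"
      by (auto simp: A_part_eq A_alg_simps)
  qed (auto simp: A_part_eq A_alg_simps in_keys_iff lookup_map_zero)
  show "\<one>\<^bsub>A_alg m\<^esub> \<in> A_part m (0, 0)"
    by (simp add: A_part_eq A_alg_simps partitions_def bidegree_def wt_def)
  show "f \<otimes>\<^bsub>A_alg m\<^esub> g \<in> A_part m (n1 + n2, w1 + w2)"
    if "f \<in> A_part m (n1, w1)" "g \<in> A_part m (n2, w2)" for f g n1 w1 n2 w2
  proof -
    have "lam \<in> partitions \<and> bidegree m lam = (n1 + n2, w1 + w2)"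
        if lam: "lam \<in> Poly_Mapping.keys (A.ext m f g)" for lam
    proof -
      obtain \<mu> \<nu> where "\<mu> \<in> Poly_Mapping.keys f" "\<nu> \<in> Poly_Mapping.keys g" "lam = part_mult m \<mu> \<nu>"
        using A_ext_keys[of m f g] lam by blast
      moreover from this have "bidegree m \<mu> = (n1, w1)" "bidegree m \<nu> = (n2, w2)"
        using \<open>f \<in> _\<close> \<open>g \<in> _\<close> by (simp_all add: A_part_eq)
      ultimately show ?thesis
        by (simp add: bidegree_def length_part_mult wt_part_mult[OF assms] part_mult_in_partitions)
    qed
    then show ?thesis
      by (auto simp: A_part_eq A_alg_simps)
  qed
qed (simp_all add: A_alg_simps A_ext_smult)


section \<open>The isomorphism and its inverse\<close>

text \<open>Defined for all lists, so that additivity is unconditional; sortedness enters only when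
  inverting it.\<close>

definition to_sym :: "(nat list \<Rightarrow>\<^sub>0 rat) \<Rightarrow> (nat \<Rightarrow>\<^sub>0 rat mpoly)" where
  "to_sym f = (\<Sum>lam\<in>Poly_Mapping.keys f.
      Poly_Mapping.single (length lam) (mconst (Poly_Mapping.lookup f lam) * P lam))"

text \<open>Zeros are kept, because zero parts count towards the length of a partition.\<close>

definition exponents :: "nat \<Rightarrow> (nat \<Rightarrow>\<^sub>0 nat) \<Rightarrow> nat list" where
  "exponents n e = map (Poly_Mapping.lookup e) [0..<n]"

definition poly_to_part :: "nat \<Rightarrow> rat mpoly \<Rightarrow> (nat list \<Rightarrow>\<^sub>0 rat)" where
  "poly_to_part n p = (\<Sum>e\<in>Poly_Mapping.keys p.
      Poly_Mapping.single (sort (exponents n e)) (Poly_Mapping.lookup p e / fact n))"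

definition of_sym :: "(nat \<Rightarrow>\<^sub>0 rat mpoly) \<Rightarrow> (nat list \<Rightarrow>\<^sub>0 rat)" where
  "of_sym f = (\<Sum>n\<in>Poly_Mapping.keys f. poly_to_part n (Poly_Mapping.lookup f n))"

section \<open>Additivity and values on basis vectors\<close>

lemma additive_to_sym: "Modules.additive to_sym"
  unfolding to_sym_def
  by (rule additive_sum_keys) (rule additive_compose[OF additive_single additive_mconst_mult])

lemma additive_poly_to_part: "Modules.additive (poly_to_part n)"
  unfolding poly_to_part_def
  by (rule additive_sum_keys) (simp add: additive_def single_add add_divide_distrib)

lemma additive_of_sym: "Modules.additive of_sym"
  unfolding of_sym_def by (rule additive_sum_keys) (rule additive_poly_to_part)

lemma to_sym_single: "to_sym (Poly_Mapping.single lam c) =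
    Poly_Mapping.single (length lam) (mconst c * P lam)"
  by (simp add: to_sym_def mconst_zero)

lemma poly_to_part_single:
  "poly_to_part n (Poly_Mapping.single e c) =
      Poly_Mapping.single (sort (exponents n e)) (c / fact n)"
  by (simp add: poly_to_part_def)

lemma of_sym_single: "of_sym (Poly_Mapping.single n p) = poly_to_part n p"
  by (simp add: of_sym_def additive.zero[OF additive_poly_to_part])

text \<open>Entry \<sigma> i of the exponent list is \<open>lam ! i\<close>, so permuting the list
  by \<sigma> gives back \<open>lam\<close>.\<close>

lemma mset_exponents_monomial:
  assumes "\<sigma> permutes {..<length lam}"
  shows "mset (exponents (length lam) (\<Sum>i<length lam. Poly_Mapping.single (\<sigma> i) (lam ! i))) =
      mset lam"
proof -
  let ?n = "length lam"
  let ?e = "\<Sum>i<?n. Poly_Mapping.single (\<sigma> i) (lam ! i)"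
  have "permute_list \<sigma> (exponents ?n ?e) = lam"
  proof (rule nth_equalityI)
    show "permute_list \<sigma> (exponents ?n ?e) ! i = lam ! i"
      if "i < length (permute_list \<sigma> (exponents ?n ?e))" for i
      using that assms permutes_in_image[OF assms, of i]
      by (simp add: permute_list_nth exponents_def lookup_monomial_exponent)
  qed (simp add: exponents_def)
  then show ?thesis
    using mset_permute_list[of \<sigma> "exponents ?n ?e"] assms by (simp add: exponents_def)
qed

text \<open>All n! terms of \<open>P lam\<close>, repetitions included, sort back to the already
  sorted \<open>lam\<close>, and each contributes c / n!.\<close>

lemma of_sym_to_sym:
  assumes "Poly_Mapping.keys f \<subseteq> partitions"
  shows "of_sym (to_sym f) = f"
proof (rule additive_ext[where f = f and F = "\<lambda>f. of_sym (to_sym f)" and G = "\<lambda>f. f"])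
  fix lam c assume "lam \<in> Poly_Mapping.keys f"
  then have "sorted lam"
    using assms by (auto simp: partitions_def)
  then have sort: "sort (exponents (length lam) (\<Sum>i<length lam.
      Poly_Mapping.single (\<sigma> i) (lam ! i))) = lam"
    if "\<sigma> permutes {..<length lam}" for \<sigma>
    using mset_exponents_monomial[OF that] sort_eq_sort_iff sorted_sort_id by metis
  have "of_sym (to_sym (Poly_Mapping.single lam c)) =
      (\<Sum>\<sigma> | \<sigma> permutes {..<length lam}. Poly_Mapping.single lam (c / fact (length lam)))"
    by (simp add: to_sym_single of_sym_single mconst_mult_P additive.sum[OF additive_poly_to_part]
        poly_to_part_single sort)
  also have "\<dots> = Poly_Mapping.single lam (\<Sum>\<sigma> | \<sigma> permutes {..<length lam}. c / fact (length lam))"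
    by (rule additive.sum[OF additive_single, symmetric])
  also have "\<dots> = Poly_Mapping.single lam c"
    by (simp add: card_permutations)
  finally show "of_sym (to_sym (Poly_Mapping.single lam c)) = Poly_Mapping.single lam c" .
qed (rule additive_compose[OF additive_of_sym additive_to_sym], simp add: additive_def)

text \<open>Exhibits \<open>P\<close> of an exponent list as the sum of all translates of one
  monomial, the form in which averaging becomes visible.\<close>

lemma P_exponents:
  assumes "Poly_Mapping.keys e \<subseteq> {..<n}"
  shows "P (exponents n e) = (\<Sum>\<sigma> | \<sigma> permutes {..<n}. msubst (\<lambda>i.
      mvar (\<sigma> i)) (Poly_Mapping.single e 1))"
proof -
  have "(\<Prod>i<n. mvar (\<sigma> i) ^ Poly_Mapping.lookup e i) =
      (\<Prod>i\<in>Poly_Mapping.keys e. mvar (\<sigma> i) ^ Poly_Mapping.lookup e i :: rat mpoly)" for \<sigma>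
    by (rule prod.mono_neutral_right) (use assms in \<open>auto simp: in_keys_iff\<close>)
  then show ?thesis
    by (simp add: P_def exponents_def msubst_single mconst_one)
qed

lemma to_sym_poly_to_part:
  assumes p: "p \<in> sym_polys n"
  shows "to_sym (poly_to_part n p) = Poly_Mapping.single n p"
proof -
  let ?c = "\<lambda>e. Poly_Mapping.lookup p e / fact n"
  \<comment> \<open>The coefficient of the monomial moves inside the substitution and 1 / n! stays
    outside, ready for averaging.\<close>
  have P: "mconst (?c e) * P (sort (exponents n e)) = (\<Sum>\<sigma> | \<sigma> permutes {..<n}.
      mconst (1 / fact n) * msubst (\<lambda>i. mvar (\<sigma> i)) (Poly_Mapping.single e (Poly_Mapping.lookup p e)))" if "e \<in> Poly_Mapping.keys p" for e
  proof -
    have "Poly_Mapping.keys e \<subseteq> {..<n}"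
      using p that by (auto simp: sym_polys_def)
    then have "P (sort (exponents n e)) =
        (\<Sum>\<sigma> | \<sigma> permutes {..<n}. msubst (\<lambda>i. mvar (\<sigma> i)) (Poly_Mapping.single e 1))"
      using P_exponents P_cong_mset[of "sort (exponents n e)" "exponents n e"] by simp
    moreover have "mconst (?c e) * msubst g (Poly_Mapping.single e 1) =
        mconst (1 / fact n) * msubst g (Poly_Mapping.single e (Poly_Mapping.lookup p e))" for g
      by (simp add: msubst_single mconst_one mconst_mult_mconst flip: mult.assoc)
    ultimately show ?thesis
      by (simp add: sum_distrib_left)
  qed
  have "to_sym (poly_to_part n p) = (\<Sum>e\<in>Poly_Mapping.keys p.
      Poly_Mapping.single n (mconst (?c e) * P (sort (exponents n e))))"
    by (simp add: poly_to_part_def additive.sum[OF additive_to_sym] to_sym_single exponents_def)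
  also have "\<dots> = Poly_Mapping.single n (\<Sum>e\<in>Poly_Mapping.keys p. \<Sum>\<sigma> | \<sigma> permutes {..<n}.
      mconst (1 / fact n) * msubst (\<lambda>i. mvar (\<sigma> i)) (Poly_Mapping.single e (Poly_Mapping.lookup p e)))"
    by (simp add: additive.sum[OF additive_single] P)
  also have "(\<Sum>e\<in>Poly_Mapping.keys p. \<Sum>\<sigma> | \<sigma> permutes {..<n}.
      mconst (1 / fact n) * msubst (\<lambda>i. mvar (\<sigma> i)) (Poly_Mapping.single e (Poly_Mapping.lookup p e))) =
      (\<Sum>\<sigma> | \<sigma> permutes {..<n}. mconst (1 / fact n) *
        msubst (\<lambda>i. mvar (\<sigma> i)) (\<Sum>e\<in>Poly_Mapping.keys p.
            Poly_Mapping.single e (Poly_Mapping.lookup p e)))"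
    unfolding additive.sum[OF additive_msubst] sum_distrib_left by (rule sum.swap)
  also have "\<dots> = (\<Sum>\<sigma> | \<sigma> permutes {..<n}. mconst (1 / fact n) * p)"
    unfolding poly_mapping_expand[symmetric] using p by (simp add: sym_polys_def)
  also have "\<dots> = mconst (\<Sum>\<sigma> | \<sigma> permutes {..<n}. 1 / fact n) * p"
    by (rule additive.sum[OF additive_mconst_mult, symmetric])
  also have "\<dots> = p"
    by (simp add: card_permutations mconst_one)
  finally show ?thesis .
qed

lemma to_sym_of_sym:
  assumes "f \<in> carrier (H_0 m)"
  shows "to_sym (of_sym f) = f"
proof -
  have "to_sym (of_sym f) = (\<Sum>n\<in>Poly_Mapping.keys f.
      Poly_Mapping.single n (Poly_Mapping.lookup f n))"
    using assms
    by (simp add: of_sym_def additive.sum[OF additive_to_sym] to_sym_poly_to_part H_0_simps)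
  then show ?thesis
    by (simp flip: poly_mapping_expand)
qed

section \<open>Supports, degrees and bijectivity\<close>

lemma lookup_to_sym_nonzero:
  assumes "Poly_Mapping.lookup (to_sym f) n \<noteq> 0"
  obtains lam where "lam \<in> Poly_Mapping.keys f" "length lam = n"
proof -
  have "(\<Sum>lam\<in>Poly_Mapping.keys f. Poly_Mapping.lookup (Poly_Mapping.single (length lam) (mconst
      (Poly_Mapping.lookup f lam) * P lam)) n) \<noteq> 0"
    using assms by (simp add: to_sym_def lookup_sum)
  then obtain lam where "lam \<in> Poly_Mapping.keys f"
    "Poly_Mapping.lookup (Poly_Mapping.single (length lam) (mconst (Poly_Mapping.lookup f lam) *
        P lam)) n \<noteq> 0"
    by (rule sum.not_neutral_contains_not_neutral)
  with that show thesis
    by (auto simp: lookup_single when_def split: if_splits)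
qed

text \<open>\<open>P lam\<close> is homogeneous of degree \<open>sum_list lam\<close>, because
  permuting variables preserves the degree of a monomial.\<close>

lemma lookup_lookup_to_sym_nonzero:
  assumes "Poly_Mapping.lookup (Poly_Mapping.lookup (to_sym f) n) e \<noteq> 0"
  obtains lam where "lam \<in> Poly_Mapping.keys f" "length lam = n" "monom_degree e = sum_list lam"
proof -
  have "(\<Sum>lam\<in>Poly_Mapping.keys f. Poly_Mapping.lookup (Poly_Mapping.lookup (
      Poly_Mapping.single (length lam) (mconst (Poly_Mapping.lookup f lam) * P lam)) n) e) \<noteq> 0"
    using assms by (simp add: to_sym_def lookup_sum)
  then obtain lam where lam: "lam \<in> Poly_Mapping.keys f"
    "Poly_Mapping.lookup (Poly_Mapping.lookup (Poly_Mapping.single (length lam) (mconst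
        (Poly_Mapping.lookup f lam) * P lam)) n) e \<noteq> 0"
    by (rule sum.not_neutral_contains_not_neutral)
  then have len: "length lam = n" and "Poly_Mapping.lookup (P lam) e \<noteq> 0"
    by (auto simp: lookup_single when_def lookup_mconst_mult split: if_splits)
  then have "(\<Sum>\<sigma> | \<sigma> permutes {..<n}. Poly_Mapping.lookup (Poly_Mapping.single (\<Sum>i<n.
      Poly_Mapping.single (\<sigma> i) (lam ! i)) 1) e) \<noteq> (0::rat)"
    by (simp add: P_eq_sum_single lookup_sum)
  then obtain \<sigma> where "\<sigma> \<in> {\<sigma>. \<sigma> permutes {..<n}}"
    "Poly_Mapping.lookup (Poly_Mapping.single (\<Sum>i<n. Poly_Mapping.single (\<sigma> i) (lam ! i)) 1) e \<noteq>
        (0::rat)"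
    by (rule sum.not_neutral_contains_not_neutral)
  then have "monom_degree e = (\<Sum>i<n. lam ! i)"
    by (auto simp: lookup_single when_def monom_degree_monomial_exponent split: if_splits)
  then have "monom_degree e = sum_list lam"
    using len by (simp add: sum_list_sum_nth atLeast0LessThan)
  with that lam(1) len show thesis
    by blast
qed

lemma to_sym_in_carrier: "to_sym f \<in> carrier (H_0 m)"
proof -
  have sum: "sum F S \<in> sym_polys n" if "\<And>x. x \<in> S \<Longrightarrow> F x \<in> sym_polys n"
    for F :: "nat list \<Rightarrow> rat mpoly" and S n
    using that
    by (induction S rule: infinite_finite_induct) (simp_all add: sym_polys_zero sym_polys_add)
  have "Poly_Mapping.lookup (to_sym f) n \<in> sym_polys n" for n
    unfolding to_sym_def lookup_sum
    by (intro sum)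
       (auto simp: lookup_single when_def sym_polys_zero intro!: sym_polys_mconst_mult
           P_in_sym_polys)
  then show ?thesis
    by (simp add: H_0_simps)
qed

lemma of_sym_keys:
  assumes "lam \<in> Poly_Mapping.keys (of_sym f)"
  obtains n e where "n \<in> Poly_Mapping.keys f" "e \<in> Poly_Mapping.keys (Poly_Mapping.lookup f n)"
    "lam = sort (exponents n e)"
proof -
  have "(\<Sum>n\<in>Poly_Mapping.keys f. Poly_Mapping.lookup (poly_to_part n (Poly_Mapping.lookup f n)) lam)
      \<noteq> 0"
    using assms by (simp add: of_sym_def in_keys_iff lookup_sum)
  then obtain n where n: "n \<in> Poly_Mapping.keys f" "Poly_Mapping.lookup (poly_to_part n
      (Poly_Mapping.lookup f n)) lam \<noteq> 0"
    by (rule sum.not_neutral_contains_not_neutral)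
  then have "(\<Sum>e\<in>Poly_Mapping.keys (Poly_Mapping.lookup f n).
      Poly_Mapping.lookup (Poly_Mapping.single (sort (exponents n e)) (Poly_Mapping.lookup
          (Poly_Mapping.lookup f n) e / fact n)) lam) \<noteq> 0"
    by (simp add: poly_to_part_def lookup_sum)
  then obtain e where "e \<in> Poly_Mapping.keys (Poly_Mapping.lookup f n)"
    "Poly_Mapping.lookup (Poly_Mapping.single (sort (exponents n e)) (Poly_Mapping.lookup
        (Poly_Mapping.lookup f n) e / fact n)) lam \<noteq> 0"
    by (rule sum.not_neutral_contains_not_neutral)
  with n(1) that show thesis
    by (auto simp: lookup_single when_def split: if_splits)
qed

lemma of_sym_in_carrier: "of_sym f \<in> carrier (A_alg m)"
  by (auto simp: A_alg_simps partitions_def elim: of_sym_keys)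

lemma bij_betw_to_sym: "bij_betw to_sym (carrier (A_alg m)) (carrier (H_0 m))"
  by (rule bij_betw_byWitness[where f' = of_sym])
     (auto simp: A_alg_simps(1) of_sym_to_sym to_sym_of_sym to_sym_in_carrier
        intro: of_sym_in_carrier[unfolded A_alg_simps(1), THEN CollectD, THEN subsetD])

lemma sum_list_sort_exponents:
  assumes "Poly_Mapping.keys e \<subseteq> {..<n}"
  shows "sum_list (sort (exponents n e)) = monom_degree e"
proof -
  have "sum_list (sort (exponents n e)) = sum_list (exponents n e)"
    by (metis mset_sort sum_mset_sum_list)
  also have "\<dots> = (\<Sum>i<n. Poly_Mapping.lookup e i)"
    by (simp add: exponents_def atLeast0LessThan flip: sum_set_upt_conv_sum_list_nat)
  also have "\<dots> = monom_degree e"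
    unfolding monom_degree_def
    by (rule sum.mono_neutral_right) (use assms in \<open>auto simp: in_keys_iff\<close>)
  finally show ?thesis .
qed

text \<open>One inclusion says that \<open>to_sym\<close> preserves bidegrees. For the other,
  \<open>h\<close> is the image of \<open>of_sym h\<close>, and sorting exponents keeps their number
  and their sum.\<close>

lemma to_sym_A_part: "to_sym ` A_part m d = H_0_part m d"
proof (intro equalityI subsetI)
  obtain n w where d: "d = (n, w)"
    by (cases d)
  {
    fix h assume "h \<in> to_sym ` A_part m d"
    then obtain f where f: "f \<in> A_part m (n, w)" and h: "h = to_sym f"
      unfolding d by blast
    have "n' = n" if "n' \<in> Poly_Mapping.keys h" for n'
      using that f lookup_to_sym_nonzero[of f n'] by (auto simp: h A_part_def in_keys_iff)
    moreover have "(int m - 1) * int (n choose 2) - int (monom_degree e) = w"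
      if "e \<in> Poly_Mapping.keys (Poly_Mapping.lookup h n)" for e
    proof -
      obtain lam where "lam \<in> Poly_Mapping.keys f" "length lam = n" "monom_degree e = sum_list lam"
        using lookup_lookup_to_sym_nonzero[of f n e] \<open>e \<in> _\<close> by (auto simp: h in_keys_iff)
      with f show ?thesis
        by (auto simp: A_part_def wt_def)
    qed
    ultimately show "h \<in> H_0_part m d"
      using to_sym_in_carrier[of f m] by (auto simp: H_0_part_def coha_part_def d h H_0_def)
  next
    fix h assume "h \<in> H_0_part m d"
    then have h: "h \<in> carrier (H_0 m)" and keys: "Poly_Mapping.keys h \<subseteq> {n}"
      and deg: "\<And>e. e \<in> Poly_Mapping.keys (Poly_Mapping.lookup h n) \<Longrightarrow>
        (int m - 1) * int (n choose 2) - int (monom_degree e) = w"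
      by (auto simp: H_0_part_def coha_part_def d H_0_def)
    have "length lam = n \<and> wt m lam = w" if keys_lam: "lam \<in> Poly_Mapping.keys (of_sym h)" for lam
    proof -
      obtain e where e: "e \<in> Poly_Mapping.keys (Poly_Mapping.lookup h n)"
        and lam: "lam = sort (exponents n e)"
        using of_sym_keys[OF keys_lam] keys by blast
      have "Poly_Mapping.keys e \<subseteq> {..<n}"
        using h e by (auto simp: H_0_simps sym_polys_def)
      then show ?thesis
        using deg[OF e] sum_list_sort_exponents[of e n] by (simp add: lam wt_def exponents_def)
    qed
    then have "of_sym h \<in> A_part m d"
      using of_sym_in_carrier[of h m] by (simp add: A_part_def d)
    with to_sym_of_sym[OF h] show "h \<in> to_sym ` A_part m d"
      by (metis image_eqI)
  }
qed

text \<open>Both sides are biadditive, so basis vectors suffice; there the scalars come out by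
  \<open>shuffle_mult_mconst\<close> and \<open>shuffle_mult_P\<close> remains.\<close>

lemma to_sym_mult: "to_sym (A.ext m f g) = H.ext m (to_sym f) (to_sym g)"
proof (rule additive_ext[where f = f and F = "\<lambda>f. to_sym (A.ext m f g)"
      and G = "\<lambda>f. H.ext m (to_sym f) (to_sym g)"])
  fix \<mu> a
  show "to_sym (A.ext m (Poly_Mapping.single \<mu> a) g) =
      H.ext m (to_sym (Poly_Mapping.single \<mu> a)) (to_sym g)"
    by (rule additive_ext[where f = g and F = "\<lambda>g. to_sym (A.ext m (Poly_Mapping.single \<mu> a) g)"
          and G = "\<lambda>g. H.ext m (to_sym (Poly_Mapping.single \<mu> a)) (to_sym g)"])
       (simp_all add: A.ext_single H.ext_single to_sym_single length_part_mult shuffle_mult_mconst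
          shuffle_mult_P additive_compose[OF additive_to_sym A.ext_additive_right]
          additive_compose[OF H.ext_additive_right additive_to_sym])
qed (rule additive_compose[OF additive_to_sym A.ext_additive_left],
    rule additive_compose[OF H.ext_additive_left additive_to_sym])

lemma to_sym_smult:
  "to_sym (Poly_Mapping.map ((*) c) f) = Poly_Mapping.map ((*) (mconst c)) (to_sym f)"
proof (rule additive_ext[where f = f and F = "\<lambda>f. to_sym (Poly_Mapping.map ((*) c) f)"
      and G = "\<lambda>f. Poly_Mapping.map ((*) (mconst c)) (to_sym f)"])
  show "to_sym (Poly_Mapping.map ((*) c) (Poly_Mapping.single lam a)) =
      Poly_Mapping.map ((*) (mconst c)) (to_sym (Poly_Mapping.single lam a))" for lam a
    by (simp add: map_single_additive additive_times to_sym_single mult.assoc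
        flip: mconst_mult_mconst)
qed (rule additive_compose[OF additive_to_sym additive_map[OF additive_times]],
    rule additive_compose[OF additive_map[OF additive_times] additive_to_sym])

lemma to_sym_ring_iso: "to_sym \<in> ring_iso (A_alg m) (H_0 m)"
proof (rule ring_iso_memI)
  \<comment> \<open>For the empty partition \<open>P\<close> is one empty product, as only the
    identity permutes the empty set.\<close>
  show "to_sym \<one>\<^bsub>A_alg m\<^esub> = \<one>\<^bsub>H_0 m\<^esub>"
    by (simp add: A_alg_simps H_0_simps to_sym_single mconst_one P_def)
qed (simp_all add: to_sym_in_carrier bij_betw_to_sym A_alg_simps(2,5) H_0_simps(2,5) to_sym_mult
      additive.add[OF additive_to_sym])


theorem proposition5p3:
  fixes m :: nat
  assumes "m \<ge> 1"
  shows "\<exists>\<phi>.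
    bigraded_algebra_iso (ring_of_type_algebra :: rat ring)
      (A_alg m) (A_part m) (H_0 m) (H_0_part m) \<phi> \<and>
    (\<forall>lam\<in>partitions.
      \<phi> (Poly_Mapping.single lam 1) = Poly_Mapping.single (length lam) (P lam))"
proof (intro exI conjI ballI)
  have zero: "to_sym \<zero>\<^bsub>A_alg m\<^esub> = \<zero>\<^bsub>H_0 m\<^esub>"
    by (simp add: A_alg_simps H_0_simps additive.zero[OF additive_to_sym])
  have smult: "to_sym (a \<odot>\<^bsub>A_alg m\<^esub> f) = a \<odot>\<^bsub>H_0 m\<^esub> to_sym f" for a f
    by (simp add: A_alg_simps H_0_simps to_sym_smult)
  have A: "bigraded_algebra (ring_of_type_algebra :: rat ring) (A_alg m) (A_part m)"
    by (rule bigraded_algebra_A[OF assms])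
  have "bigraded_algebra (ring_of_type_algebra :: rat ring) (H_0 m) (H_0_part m)"
    by (rule bigraded_algebra_transfer[OF A to_sym_ring_iso zero smult to_sym_A_part])
  then show "bigraded_algebra_iso (ring_of_type_algebra :: rat ring)
      (A_alg m) (A_part m) (H_0 m) (H_0_part m) to_sym"
    unfolding bigraded_algebra_iso_def
    using A to_sym_ring_iso smult to_sym_A_part by blast
  show "to_sym (Poly_Mapping.single lam 1) = Poly_Mapping.single (length lam) (P lam)" for lam
    by (simp add: to_sym_single mconst_one)
qed

end
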